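(* Let $\phi'$ and $\psi$ be the random maps $\mathcal B\to\mathcal B$ and $\rho_0:\mathcal B\to\mathcal B$ the deterministic map defined in the context. For every $\sigma>0$ and $z\in\mathbb R$, let $\xi_\psi$ be the unique solution $\xi\in\mathcal B$ of $\psi(\xi)+\rho_0(\xi)=0$, and let $\xi'_\phi$ be the unique solution of $\phi'(\xi)+\rho_0(\xi)=0$ (both equations are solved sequentially in the order $\ldots\to\theta(l)\to p(l)\to\omega(l)\to q(l)\to\theta(l+1)\to\ldots$, so each has exactly one solution). Then $\xi_\psi$ and $\xi'_\phi$ have identical distributions; that is, for every measurable function $h:\mathcal B\to\mathbb R$ (for which the expectations make sense), $$\mathbb E[h(\xi_\psi)]=\mathbb E[h(\xi'_\phi)].$$
   Context: **Data.** $n,m,J,L$ are positive integers; $\mathcal Z$ and $\mathcal Y$ are finite sets with a map $\zeta\mapsto y(\zeta)$ from $\mathcal Z$ to $\mathcal Y$. The latent labels $\zeta_1,\dots,\zeta_m\in\mathcal Z$ are regarded as fixed (one conditions on them), $y_i=y(\zeta_i)$, $\mathbf y=(y_i)_i$. The samples $x_i\in\mathbb R^n$ are independent Gaussian vectors with mean $\hat x(\zeta_i)$ and covariance $R(\zeta_i)$, where $\hat x(\zeta)\in\mathbb R^n$ and $R(\zeta)$ is an $n\times n$ positive semidefinite matrix with symmetric positive semidefinite square root $R^{1/2}(\zeta)$. $\hat{\mathbf X}$ and $\tilde{\mathbf X}$ are the $n\times m$ matrices with columns $\hat x(\zeta_i)$ and $x_i-\hat x(\zeta_i)$. **Query maps.**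 Time runs over $l=0,\dots,L-1$. Given $q(l)\in\mathbb R^{n\times J}$, $p(l)\in\mathbb R^{m\times J}$, put $q^l=(q(0),\dots,q(l))$, $p^l=(p(0),\dots,p(l))$. Given differentiable maps $\theta_l,\omega_l$, define $$\theta(l)=\theta_l(q^{l-1},p^{l-1};\mathbf y)\in\mathbb R^{n\times J},\qquad \omega(l)=\omega_l(p^{l},q^{l-1};\mathbf y)\in\mathbb R^{m\times J}$$ ($\theta(0)$ depends only on $\mathbf y$). Let $\mathbf Q=[q(0),\dots,q(L-1)]$, $\mathbf P=[p(0),\dots,p(L-1)]$, $\mathbf\Theta=[\theta(0),\dots,\theta(L-1)]$ ($n\times LJ$), $\mathbf\Omega=[\omega(0),\dots,\omega(L-1)]$ ($m\times LJ$). $\mathcal B$ is the space of all $\xi=\begin{bmatrix}\mathbf Q\\ \mathbf P\end{bmatrix}$; $\mathbf\Theta,\mathbf\Omega$ and everything built from them are functions of $\xi$. **Notation.** For a matrix $\mathbf E$ with $m$ rows, $\mathbf E_\zeta$ is the submatrix of rows $i$ with $\zeta_i=\zeta$ (in a fixed order). For a collection $\{\mathbf E_\zeta\}$, $[\mathbf E_\zeta]_{\zeta_i=\zeta}$ is the matrix whose submatrix on rows $\{i:\zeta_i=\zeta\}$ is $\mathbf E_\zeta$. $LJ\times LJ$ matrices are viewed as $L\times L$ block matrices with $J\times J$ blocks; $(\cdot)_{\mathrm u}$ is the block upper-triangular part including diagonal blocks, $(\cdot)_{\mathrm U}$ the strictly block upper-triangular part excluding diagonal blocks. **Overlaps.**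 For $\sigma>0$, $$V_\theta(\zeta)=\mathbf\Theta^TR(\zeta)\mathbf\Theta+\sigma^2\mathbf I,\qquad V_\omega(\zeta)=\tfrac1m\mathbf\Omega_\zeta^T\mathbf\Omega_\zeta+\sigma^2\mathbf I .$$ $A_\theta(\zeta),A_\omega(\zeta)$ are block upper-triangular with $V_\theta(\zeta)=A_\theta(\zeta)^TA_\theta(\zeta)$, $V_\omega(\zeta)=A_\omega(\zeta)^TA_\omega(\zeta)$ (block Cholesky factors); they are invertible. They are given by any fixed choice that is a differentiable function of the matrix factored and whose leading $l\times l$-block part depends only on the leading $l\times l$-block part of that matrix (for example the unique choice with symmetric positive definite diagonal blocks). **Maps.** $$\rho_0(\xi)=\begin{bmatrix}\frac1m\hat{\mathbf X}\mathbf\Omega-\mathbf Q\\ \hat{\mathbf X}^T\mathbf\Theta-\mathbf P\end{bmatrix},\qquad \phi(\xi)=\begin{bmatrix}\frac1m\tilde{\mathbf X}\mathbf\Omega\\ \tilde{\mathbf X}^T\mathbf\Theta\end{bmatrix},$$ $$\phi'(\xi)=\phi(\xi)+\sigma\begin{bmatrix}\frac1{\sqrt m}\sum_{\zeta\in\mathcal Z}R^{1/2}(\zeta)\mathbf U_\zeta\\ \mathbf V\end{bmatrix}+\sqrt{\frac{1+z^2}{m}}\begin{bmatrix}\sum_{\zeta\in\mathcal Z}R(\zeta)\mathbf\Theta A_\theta^{-1}(\zeta)\big(\mathbf\Gamma_\zeta A_\omega(\zeta)\big)_{\mathrm u}\\ \big[\mathbf\Omega_\zeta A_\omega^{-1}(\zeta)\big(\mathbf\Gamma_\zeta^TA_\theta(\zeta)\big)_{\mathrm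 U}\big]_{\zeta_i=\zeta}\end{bmatrix},$$ $$\psi(\xi)=\begin{bmatrix}\sum_{\zeta}R^{1/2}(\zeta)\frac{\mathbf G_\zeta}{\sqrt m}A_\omega(\zeta)+\sum_{\zeta}R(\zeta)\mathbf\Theta A_\theta^{-1}(\zeta)\Big(\frac{\mathbf H_\zeta^T\mathbf\Omega_\zeta}{m}+\frac{\sigma\mathbf W_\zeta+z\mathbf\Gamma_\zeta A_\omega(\zeta)}{\sqrt m}\Big)_{\mathrm u}\\ \Big[\mathbf H_\zeta A_\theta(\zeta)+\mathbf\Omega_\zeta A_\omega^{-1}(\zeta)\Big(\frac{\mathbf G_\zeta^TR^{1/2}(\zeta)\mathbf\Theta+\sigma\mathbf W_\zeta^T+z\mathbf\Gamma_\zeta^TA_\theta(\zeta)}{\sqrt m}\Big)_{\mathrm U}\Big]_{\zeta_i=\zeta}\end{bmatrix}.$$ Here $\mathbf U_\zeta,\mathbf G_\zeta$ are $n\times LJ$, $\mathbf V$ is $m\times LJ$, $\mathbf H_\zeta$ has the size of $\mathbf\Omega_\zeta$, and $\mathbf W_\zeta,\mathbf\Gamma_\zeta$ are $LJ\times LJ$; all have i.i.d. standard Gaussian entries and are mutually independent over all $\zeta$ and independent of $\tilde{\mathbf X}$. *)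

theory Defs
  imports "HOL-Probability.Probability"
begin

text \<open>
  Dimensions are cardinalities of index types: \<open>n = CARD('n)\<close>, \<open>m = CARD('m)\<close>, \<open>J = CARD('j)\<close>.
  Time is a finite linearly ordered type \<open>'l\<close>, that is \<open>{0, \<dots>, L - 1}\<close> with \<open>L = CARD('l)\<close>,
  and the \<open>L J\<close> columns are indexed by pairs (time, column within the block).
  The stacked matrix \<open>\<xi>\<close> with blocks \<open>Q\<close> (top) and \<open>P\<close> (bottom) is the pair \<open>(Q, P)\<close>.
\<close>

type_synonym ('n, 'm, 'l, 'j) state = "(real ^ ('l \<times> 'j) ^ 'n) \<times> (real ^ ('l \<times> 'j) ^ 'm)"
type_synonym ('l, 'j) sqblock = "real ^ ('l \<times> 'j) ^ ('l \<times> 'j)"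


subsection \<open>Matrices\<close>

definition pos_semidef :: "real ^ 'k ^ 'k \<Rightarrow> bool" where
  "pos_semidef A \<longleftrightarrow> transpose A = A \<and> (\<forall>v. 0 \<le> v \<bullet> (A *v v))"

definition pos_def :: "real ^ 'k ^ 'k \<Rightarrow> bool" where
  "pos_def A \<longleftrightarrow> transpose A = A \<and> (\<forall>v. v \<noteq> 0 \<longrightarrow> 0 < v \<bullet> (A *v v))"

definition upper_part :: "('l::{finite,linorder}, 'j::finite) sqblock \<Rightarrow> ('l, 'j) sqblock" where
  "upper_part E = (\<chi> a b. if fst a \<le> fst b then E $ a $ b else 0)"

definition strict_upper_part :: "('l::{finite,linorder}, 'j::finite) sqblock \<Rightarrow> ('l, 'j) sqblock" where
  "strict_upper_part E = (\<chi> a b. if fst a < fst b then E $ a $ b else 0)"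

definition block_upper_triangular :: "('l::{finite,linorder}, 'j::finite) sqblock \<Rightarrow> bool" where
  "block_upper_triangular E \<longleftrightarrow> (\<forall>a b. fst b < fst a \<longrightarrow> E $ a $ b = 0)"

definition same_leading_blocks ::
  "'l \<Rightarrow> ('l::{finite,linorder}, 'j::finite) sqblock \<Rightarrow> ('l, 'j) sqblock \<Rightarrow> bool" where
  "same_leading_blocks l V V' \<longleftrightarrow>
     (\<forall>a b. fst a \<le> l \<longrightarrow> fst b \<le> l \<longrightarrow> V $ a $ b = V' $ a $ b)"

text \<open>
  An admissible choice of block Cholesky factor. Differentiability is relative to the set of
  symmetric positive definite matrices, which is open in the space of symmetric matrices.
\<close>

definition block_cholesky ::
  "(('l::{finite,linorder}, 'j::finite) sqblock \<Rightarrow> ('l, 'j) sqblock) \<Rightarrow> bool" where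
  "block_cholesky c \<longleftrightarrow>
     (\<forall>V. pos_def V \<longrightarrow> block_upper_triangular (c V) \<and> V = transpose (c V) ** c V) \<and>
     c differentiable_on {V. pos_def V} \<and>
     (\<forall>l V V'. pos_def V \<longrightarrow> pos_def V' \<longrightarrow> same_leading_blocks l V V' \<longrightarrow>
        same_leading_blocks l (c V) (c V'))"

text \<open>
  The submatrix \<open>E\<^sub>\<zeta>\<close> of the rows with label \<open>\<zeta>\<close> is kept at full size, with zeros in the other
  rows. This does not change products \<open>E\<^sub>\<zeta>\<^sup>T F\<^sub>\<zeta>\<close>, and a product \<open>E\<^sub>\<zeta> A\<close> stays in the same form.
\<close>

definition rows_with :: "('m \<Rightarrow> 'z) \<Rightarrow> 'z \<Rightarrow> real ^ 'k ^ 'm \<Rightarrow> real ^ 'k ^ 'm" where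
  "rows_with lab \<zeta> E = (\<chi> i. if lab i = \<zeta> then E $ i else 0)"

definition assemble_rows :: "('m \<Rightarrow> 'z) \<Rightarrow> ('z \<Rightarrow> real ^ 'k ^ 'm) \<Rightarrow> real ^ 'k ^ 'm" where
  "assemble_rows lab E = (\<chi> i. E (lab i) $ i)"


subsection \<open>Deterministic data\<close>

text \<open>
  The maps \<open>query_theta D l\<close> and \<open>query_omega D l\<close> take the whole of \<open>\<xi>\<close>; that they depend on the
  past only is the content of \<open>causal_theta\<close> and \<open>causal_omega\<close>. \<open>chol_theta\<close> and \<open>chol_omega\<close> map
  \<open>\<zeta>\<close> and the overlap matrix \<open>V\<^sub>\<theta>(\<zeta>)\<close>, resp. \<open>V\<^sub>\<omega>(\<zeta>)\<close>, to its block Cholesky factor.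
\<close>

record ('n::finite, 'm::finite, 'l::finite, 'j::finite, 'z, 'y) query_data =
  label :: "'m \<Rightarrow> 'z"
  obs :: "'z \<Rightarrow> 'y"
  mean :: "'z \<Rightarrow> real ^ 'n"
  covar :: "'z \<Rightarrow> real ^ 'n ^ 'n"
  covar_root :: "'z \<Rightarrow> real ^ 'n ^ 'n"
  query_theta :: "'l \<Rightarrow> ('n, 'm, 'l, 'j) state \<Rightarrow> ('m \<Rightarrow> 'y) \<Rightarrow> real ^ 'j ^ 'n"
  query_omega :: "'l \<Rightarrow> ('n, 'm, 'l, 'j) state \<Rightarrow> ('m \<Rightarrow> 'y) \<Rightarrow> real ^ 'j ^ 'm"
  chol_theta :: "'z \<Rightarrow> ('l, 'j) sqblock \<Rightarrow> ('l, 'j) sqblock"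
  chol_omega :: "'z \<Rightarrow> ('l, 'j) sqblock \<Rightarrow> ('l, 'j) sqblock"

definition same_cols_lt ::
  "'l::{finite,linorder} \<Rightarrow> real ^ ('l \<times> 'j::finite) ^ 'k \<Rightarrow> real ^ ('l \<times> 'j) ^ 'k \<Rightarrow> bool" where
  "same_cols_lt l E E' \<longleftrightarrow> (\<forall>a k j. k < l \<longrightarrow> E $ a $ (k, j) = E' $ a $ (k, j))"

definition same_cols_le ::
  "'l::{finite,linorder} \<Rightarrow> real ^ ('l \<times> 'j::finite) ^ 'k \<Rightarrow> real ^ ('l \<times> 'j) ^ 'k \<Rightarrow> bool" where
  "same_cols_le l E E' \<longleftrightarrow> (\<forall>a k j. k \<le> l \<longrightarrow> E $ a $ (k, j) = E' $ a $ (k, j))"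

definition causal_theta ::
  "('l::{finite,linorder} \<Rightarrow> ('n::finite, 'm::finite, 'l, 'j::finite) state \<Rightarrow> ('m \<Rightarrow> 'y) \<Rightarrow> real ^ 'j ^ 'n) \<Rightarrow> bool"
where
  "causal_theta f \<longleftrightarrow>
     (\<forall>l yv Q P Q' P'. same_cols_lt l Q Q' \<longrightarrow> same_cols_lt l P P' \<longrightarrow>
        f l (Q, P) yv = f l (Q', P') yv)"

definition causal_omega ::
  "('l::{finite,linorder} \<Rightarrow> ('n::finite, 'm::finite, 'l, 'j::finite) state \<Rightarrow> ('m \<Rightarrow> 'y) \<Rightarrow> real ^ 'j ^ 'm) \<Rightarrow> bool"
where
  "causal_omega f \<longleftrightarrow>
     (\<forall>l yv Q P Q' P'. same_cols_lt l Q Q' \<longrightarrow> same_cols_le l P P' \<longrightarrow>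
        f l (Q, P) yv = f l (Q', P') yv)"

definition query_assms ::
  "('n::finite, 'm::finite, 'l::{finite,linorder}, 'j::finite, 'z, 'y) query_data
     \<Rightarrow> bool" where
  "query_assms D \<longleftrightarrow>
     (\<forall>\<zeta>. pos_semidef (covar D \<zeta>)) \<and>
     (\<forall>\<zeta>. pos_semidef (covar_root D \<zeta>) \<and> covar_root D \<zeta> ** covar_root D \<zeta> = covar D \<zeta>) \<and>
     causal_theta (query_theta D) \<and>
     causal_omega (query_omega D) \<and>
     (\<forall>l yv. (\<lambda>\<xi>. query_theta D l \<xi> yv) differentiable_on UNIV) \<and>
     (\<forall>l yv. (\<lambda>\<xi>. query_omega D l \<xi> yv) differentiable_on UNIV) \<and>
     (\<forall>\<zeta>. block_cholesky (chol_theta D \<zeta>)) \<and>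
     (\<forall>\<zeta>. block_cholesky (chol_omega D \<zeta>))"

definition obs_vec :: "('n::finite, 'm::finite, 'l::finite, 'j::finite, 'z, 'y) query_data
     \<Rightarrow> 'm \<Rightarrow> 'y" where
  "obs_vec D i = obs D (label D i)"

definition Theta ::
  "('n::finite, 'm::finite, 'l::finite, 'j::finite, 'z, 'y) query_data
     \<Rightarrow> ('n, 'm, 'l, 'j) state
     \<Rightarrow> real ^ ('l \<times> 'j) ^ 'n" where
  "Theta D \<xi> = (\<chi> a k. query_theta D (fst k) \<xi> (obs_vec D) $ a $ snd k)"

definition Omega ::
  "('n::finite, 'm::finite, 'l::finite, 'j::finite, 'z, 'y) query_data
     \<Rightarrow> ('n, 'm, 'l, 'j) state
     \<Rightarrow> real ^ ('l \<times> 'j) ^ 'm" where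
  "Omega D \<xi> = (\<chi> i k. query_omega D (fst k) \<xi> (obs_vec D) $ i $ snd k)"

definition Omega_sub ::
  "('n::finite, 'm::finite, 'l::finite, 'j::finite, 'z, 'y) query_data
     \<Rightarrow> 'z \<Rightarrow> ('n, 'm, 'l, 'j) state
     \<Rightarrow> real ^ ('l \<times> 'j) ^ 'm" where
  "Omega_sub D \<zeta> \<xi> = rows_with (label D) \<zeta> (Omega D \<xi>)"

definition V_theta ::
  "('n::finite, 'm::finite, 'l::finite, 'j::finite, 'z, 'y) query_data
     \<Rightarrow> real \<Rightarrow> 'z \<Rightarrow> ('n, 'm, 'l, 'j) state
     \<Rightarrow> ('l, 'j) sqblock" where
  "V_theta D \<sigma> \<zeta> \<xi> =
     transpose (Theta D \<xi>) ** covar D \<zeta> ** Theta D \<xi> + \<sigma>\<^sup>2 *\<^sub>R mat 1"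

definition V_omega ::
  "('n::finite, 'm::finite, 'l::finite, 'j::finite, 'z, 'y) query_data
     \<Rightarrow> real \<Rightarrow> 'z \<Rightarrow> ('n, 'm, 'l, 'j) state
     \<Rightarrow> ('l, 'j) sqblock" where
  "V_omega D \<sigma> \<zeta> \<xi> =
     (1 / real CARD('m)) *\<^sub>R (transpose (Omega_sub D \<zeta> \<xi>) ** Omega_sub D \<zeta> \<xi>) + \<sigma>\<^sup>2 *\<^sub>R mat 1"

definition A_theta ::
  "('n::finite, 'm::finite, 'l::finite, 'j::finite, 'z, 'y) query_data
     \<Rightarrow> real \<Rightarrow> 'z \<Rightarrow> ('n, 'm, 'l, 'j) state
     \<Rightarrow> ('l, 'j) sqblock" where
  "A_theta D \<sigma> \<zeta> \<xi> = chol_theta D \<zeta> (V_theta D \<sigma> \<zeta> \<xi>)"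

definition A_omega ::
  "('n::finite, 'm::finite, 'l::finite, 'j::finite, 'z, 'y) query_data
     \<Rightarrow> real \<Rightarrow> 'z \<Rightarrow> ('n, 'm, 'l, 'j) state
     \<Rightarrow> ('l, 'j) sqblock" where
  "A_omega D \<sigma> \<zeta> \<xi> = chol_omega D \<zeta> (V_omega D \<sigma> \<zeta> \<xi>)"

definition Xhat :: "('n::finite, 'm::finite, 'l::finite, 'j::finite, 'z, 'y) query_data
     \<Rightarrow> real ^ 'm ^ 'n" where
  "Xhat D = (\<chi> a i. mean D (label D i) $ a)"


subsection \<open>Random data\<close>

text \<open>
  A realisation of the samples and of the auxiliary noise. The matrices \<open>H\<^sub>\<zeta>\<close>, whose rows are the
  \<open>i\<close> with label \<open>\<zeta>\<close>, together form the single \<open>m \<times> L J\<close> matrix \<open>noise_H\<close>.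
\<close>

record ('n::finite, 'm::finite, 'l::finite, 'j::finite, 'z) noise =
  sample :: "'m \<Rightarrow> real ^ 'n"
  noise_U :: "'z \<Rightarrow> real ^ ('l \<times> 'j) ^ 'n"
  noise_V :: "real ^ ('l \<times> 'j) ^ 'm"
  noise_G :: "'z \<Rightarrow> real ^ ('l \<times> 'j) ^ 'n"
  noise_H :: "real ^ ('l \<times> 'j) ^ 'm"
  noise_W :: "'z \<Rightarrow> ('l, 'j) sqblock"
  noise_Gamma :: "'z \<Rightarrow> ('l, 'j) sqblock"

datatype ('n, 'm, 'k, 'z) noise_index =
    Ind_U 'z 'n 'k
  | Ind_V 'm 'k
  | Ind_G 'z 'n 'k
  | Ind_H 'm 'k
  | Ind_W 'z 'k 'k
  | Ind_Gamma 'z 'k 'k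

fun noise_entry ::
  "('n::finite, 'm::finite, 'l \<times> 'j, 'z) noise_index \<Rightarrow> ('n, 'm, 'l::finite, 'j::finite, 'z) noise \<Rightarrow> real" where
  "noise_entry (Ind_U \<zeta> a k) N = noise_U N \<zeta> $ a $ k"
| "noise_entry (Ind_V i k) N = noise_V N $ i $ k"
| "noise_entry (Ind_G \<zeta> a k) N = noise_G N \<zeta> $ a $ k"
| "noise_entry (Ind_H i k) N = noise_H N $ i $ k"
| "noise_entry (Ind_W \<zeta> k k') N = noise_W N \<zeta> $ k $ k'"
| "noise_entry (Ind_Gamma \<zeta> k k') N = noise_Gamma N \<zeta> $ k $ k'"

definition Xtilde ::
  "('n::finite, 'm::finite, 'l::finite, 'j::finite, 'z, 'y) query_data
     \<Rightarrow> ('n, 'm, 'l, 'j, 'z) noise \<Rightarrow> real ^ 'm ^ 'n" where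
  "Xtilde D N = (\<chi> a i. (sample N i - mean D (label D i)) $ a)"

text \<open>
  The covariance may be singular, so a Gaussian vector need not have a density: it is required that
  every linear functional is univariate Gaussian, a point mass in the case of variance zero.
\<close>

definition gaussian_vector ::
  "'a measure \<Rightarrow> ('a \<Rightarrow> real ^ 'n) \<Rightarrow> real ^ 'n \<Rightarrow> real ^ 'n ^ 'n \<Rightarrow> bool" where
  "gaussian_vector M X \<mu> S \<longleftrightarrow>
     X \<in> borel_measurable M \<and>
     (\<forall>a. if a \<bullet> (S *v a) = 0
          then AE w in M. a \<bullet> X w = a \<bullet> \<mu>
          else distributed M lborel (\<lambda>w. a \<bullet> X w) (normal_density (a \<bullet> \<mu>) (sqrt (a \<bullet> (S *v a)))))"

text \<open>
  The samples are vectors and the noise entries are scalars, so their joint mutual independence is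
  stated for the \<open>\<sigma>\<close>-algebras they generate, indexed by a disjoint sum.
\<close>

definition noise_assms ::
  "'a measure \<Rightarrow> ('n::finite, 'm::finite, 'l::finite, 'j::finite, 'z, 'y) query_data
     \<Rightarrow> ('a \<Rightarrow> ('n, 'm, 'l, 'j, 'z) noise) \<Rightarrow> bool" where
  "noise_assms M D N \<longleftrightarrow>
     (\<forall>i. gaussian_vector M (\<lambda>w. sample (N w) i) (mean D (label D i)) (covar D (label D i))) \<and>
     (\<forall>\<iota>. distributed M lborel (\<lambda>w. noise_entry \<iota> (N w)) std_normal_density) \<and>
     prob_space.indep_sets M
       (case_sum
         (\<lambda>i. {(\<lambda>w. sample (N w) i) -` A \<inter> space M | A. A \<in> sets borel})
         (\<lambda>\<iota>. {(\<lambda>w. noise_entry \<iota> (N w)) -` A \<inter> space M | A. A \<in> sets borel}))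
       UNIV"


subsection \<open>The maps\<close>

definition rho0 ::
  "('n::finite, 'm::finite, 'l::finite, 'j::finite, 'z, 'y) query_data
     \<Rightarrow> ('n, 'm, 'l, 'j) state \<Rightarrow> ('n, 'm, 'l, 'j) state" where
  "rho0 D \<xi> =
     ((1 / real CARD('m)) *\<^sub>R (Xhat D ** Omega D \<xi>) - fst \<xi>,
      transpose (Xhat D) ** Theta D \<xi> - snd \<xi>)"

definition phi ::
  "('n::finite, 'm::finite, 'l::finite, 'j::finite, 'z, 'y) query_data
     \<Rightarrow> ('n, 'm, 'l, 'j, 'z) noise
     \<Rightarrow> ('n, 'm, 'l, 'j) state \<Rightarrow> ('n, 'm, 'l, 'j) state" where
  "phi D N \<xi> =
     ((1 / real CARD('m)) *\<^sub>R (Xtilde D N ** Omega D \<xi>),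
      transpose (Xtilde D N) ** Theta D \<xi>)"

definition phi' ::
  "('n::finite, 'm::finite, 'l::{finite,linorder}, 'j::finite, 'z::finite, 'y) query_data
     \<Rightarrow> real \<Rightarrow> real \<Rightarrow> ('n, 'm, 'l, 'j, 'z) noise
     \<Rightarrow> ('n, 'm, 'l, 'j) state \<Rightarrow> ('n, 'm, 'l, 'j) state" where
  "phi' D \<sigma> z N \<xi> =
     phi D N \<xi>
     + \<sigma> *\<^sub>R
        ((1 / sqrt (real CARD('m))) *\<^sub>R (\<Sum>\<zeta>\<in>UNIV. covar_root D \<zeta> ** noise_U N \<zeta>),
         noise_V N)
     + sqrt ((1 + z\<^sup>2) / real CARD('m)) *\<^sub>R
        (\<Sum>\<zeta>\<in>UNIV. covar D \<zeta> ** Theta D \<xi> ** matrix_inv (A_theta D \<sigma> \<zeta> \<xi>)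
            ** upper_part (noise_Gamma N \<zeta> ** A_omega D \<sigma> \<zeta> \<xi>),
         assemble_rows (label D) (\<lambda>\<zeta>. Omega_sub D \<zeta> \<xi> ** matrix_inv (A_omega D \<sigma> \<zeta> \<xi>)
            ** strict_upper_part (transpose (noise_Gamma N \<zeta>) ** A_theta D \<sigma> \<zeta> \<xi>)))"

definition psi ::
  "('n::finite, 'm::finite, 'l::{finite,linorder}, 'j::finite, 'z::finite, 'y) query_data
     \<Rightarrow> real \<Rightarrow> real \<Rightarrow> ('n, 'm, 'l, 'j, 'z) noise
     \<Rightarrow> ('n, 'm, 'l, 'j) state \<Rightarrow> ('n, 'm, 'l, 'j) state" where
  "psi D \<sigma> z N \<xi> =
     ((\<Sum>\<zeta>\<in>UNIV. covar_root D \<zeta> ** ((1 / sqrt (real CARD('m))) *\<^sub>R noise_G N \<zeta>)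
          ** A_omega D \<sigma> \<zeta> \<xi>)
      + (\<Sum>\<zeta>\<in>UNIV. covar D \<zeta> ** Theta D \<xi> ** matrix_inv (A_theta D \<sigma> \<zeta> \<xi>)
          ** upper_part
              ((1 / real CARD('m)) *\<^sub>R
                 (transpose (rows_with (label D) \<zeta> (noise_H N)) ** Omega_sub D \<zeta> \<xi>)
               + (1 / sqrt (real CARD('m))) *\<^sub>R
                 (\<sigma> *\<^sub>R noise_W N \<zeta> + z *\<^sub>R (noise_Gamma N \<zeta> ** A_omega D \<sigma> \<zeta> \<xi>)))),
      assemble_rows (label D) (\<lambda>\<zeta>.
        rows_with (label D) \<zeta> (noise_H N) ** A_theta D \<sigma> \<zeta> \<xi>
        + Omega_sub D \<zeta> \<xi> ** matrix_inv (A_omega D \<sigma> \<zeta> \<xi>)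
          ** strict_upper_part
              ((1 / sqrt (real CARD('m))) *\<^sub>R
                 (transpose (noise_G N \<zeta>) ** covar_root D \<zeta> ** Theta D \<xi>
                  + \<sigma> *\<^sub>R transpose (noise_W N \<zeta>)
                  + z *\<^sub>R (transpose (noise_Gamma N \<zeta>) ** A_theta D \<sigma> \<zeta> \<xi>)))))"

definition xi_phi' ::
  "('n::finite, 'm::finite, 'l::{finite,linorder}, 'j::finite, 'z::finite, 'y) query_data
     \<Rightarrow> real \<Rightarrow> real \<Rightarrow> ('n, 'm, 'l, 'j, 'z) noise
     \<Rightarrow> ('n, 'm, 'l, 'j) state" where
  "xi_phi' D \<sigma> z N = (THE \<xi>. phi' D \<sigma> z N \<xi> + rho0 D \<xi> = 0)"

definition xi_psi ::
  "('n::finite, 'm::finite, 'l::{finite,linorder}, 'j::finite, 'z::finite, 'y) query_data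
     \<Rightarrow> real \<Rightarrow> real \<Rightarrow> ('n, 'm, 'l, 'j, 'z) noise
     \<Rightarrow> ('n, 'm, 'l, 'j) state" where
  "xi_psi D \<sigma> z N = (THE \<xi>. psi D \<sigma> z N \<xi> + rho0 D \<xi> = 0)"

end

theory Submission
  imports Defs
begin

text \<open>
  Both equations are fixed-point equations \<open>\<xi> = g(\<xi>)\<close> of causal maps, continuous in \<open>\<xi>\<close>. Rounding the
  values of \<open>g\<close> to a grid gives a causal equation with countably many possible solutions, where the
  event that the solution is \<open>y\<close> is the event that \<open>g(y)\<close> rounds to \<open>y\<close>; its probability involves only
  the law of \<open>g(y)\<close> at the fixed point \<open>y\<close>. Refining the grid, the law of the solution is determined by
  the laws of \<open>g(y)\<close> for fixed \<open>y\<close>, so no densities or Jacobians are needed, even for singular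
  covariances. For fixed \<open>\<xi>\<close>, both \<open>\<psi>(\<xi>)\<close> and \<open>\<phi>'(\<xi>)\<close> are centred Gaussian, and a computation with the block
  Cholesky factors shows that every linear functional has the same variance under both.
\<close>

section \<open>Uniqueness of multivariate characteristic functions\<close>

text \<open>The obstacle is that a solution evaluates the random map at a random point, so its law
  seems to involve the joint law of all values of the map, whereas the two maps are comparable only
  at one deterministic point at a time. Being a fixed point at y concerns the single value at y, but
  with a continuum of candidates each such event may be null; hence the grid. It acts entrywise
  because any other discretisation might destroy causality. The shape of the maps comes from the
  variance computation. The diagonal blocks belong to exactly one of the parts u and U: this keeps
  p(l) from reading omega(l), and it makes the two contributions to the coefficient of
  \<open>W\<close> orthogonal. The G, H and W terms of \<psi> have the variance of the sample, U and
  V terms of \<phi>' plus 1/m times the squared norm of a matrix that is also, up to scale, the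
  coefficient of \<Gamma>. The \<Gamma> term of \<psi> adds z^2/m times that norm, which explains
  the factor sqrt((1 + z^2)/m). Positive \<sigma> makes the overlaps positive definite and their
  factors invertible.\<close>

text \<open>The weight is normalised to a probability density and the measure projected along
  \<open>v\<close>, where one-dimensional Levy uniqueness applies. The weight is what later allows
  conditioning on other coordinates.\<close>

lemma weighted_marginal_eq:
  fixes \<mu> \<nu> :: "'e::euclidean_space measure" and W :: "'e \<Rightarrow> real"
  assumes "prob_space \<mu>" "prob_space \<nu>"
    and sets [measurable_cong, simp]: "sets \<mu> = sets borel" "sets \<nu> = sets borel"
    and W [measurable]: "W \<in> borel_measurable borel"
    and W_bounds: "\<And>x. 0 \<le> W x" "\<And>x. W x \<le> B"
    and eq: "\<And>u c. (\<integral>x. W x * cos (u * (x \<bullet> v) + c) \<partial>\<mu>) = (\<integral>x. W x * cos (u * (x \<bullet> v) + c) \<partial>\<nu>)"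
    and A [measurable]: "A \<in> sets borel"
  shows "(\<integral>x. W x * indicator A (x \<bullet> v) \<partial>\<mu>) = (\<integral>x. W x * indicator A (x \<bullet> v) \<partial>\<nu>)"
proof -
  interpret \<mu>: prob_space \<mu> by fact
  interpret \<nu>: prob_space \<nu> by fact
  define c where "c = (\<integral>x. W x \<partial>\<mu>)"
  have c_eq: "c = (\<integral>x. W x \<partial>\<nu>)"
    using eq[of 0 0] by (simp add: c_def)
  have int: "integrable \<mu> W" "integrable \<nu> W"
    by (rule \<mu>.integrable_const_bound[of _ B] \<nu>.integrable_const_bound[of _ B]; use W_bounds in auto)+
  have "c \<ge> 0"
    unfolding c_def using W_bounds by simp
  show ?thesis
  proof (cases "c = 0")
    \<comment> \<open>A weight of total mass zero cannot be normalised, but it vanishes almost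
      everywhere under both measures.\<close>
    case True
    have "AE x in \<mu>. W x = 0" "AE x in \<nu>. W x = 0"
      using True c_eq int W_bounds by (simp_all add: c_def flip: integral_nonneg_eq_0_iff_AE)
    then have "(\<integral>x. W x * indicator A (x \<bullet> v) \<partial>\<mu>) = (\<integral>x. 0 \<partial>\<mu>)"
      "(\<integral>x. W x * indicator A (x \<bullet> v) \<partial>\<nu>) = (\<integral>x. 0 \<partial>\<nu>)"
      by (intro integral_cong_AE; force)+
    then show ?thesis by simp
  next
    case False
    with \<open>c \<ge> 0\<close> have "c > 0" by simp
    define m where "m \<rho> = distr (density \<rho> (\<lambda>x. ennreal (W x / c))) borel (\<lambda>x. x \<bullet> v)" for \<rho> :: "'e measure"
    have distribution: "real_distribution (m \<rho>)"
      if [simp, measurable_cong]: "sets \<rho> = sets borel" and "prob_space \<rho>" "c = (\<integral>x. W x \<partial>\<rho>)" "integrable \<rho> W" for \<rho>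
    proof -
      have "(\<integral>\<^sup>+x. ennreal (W x / c) \<partial>\<rho>) = ennreal (\<integral>x. W x / c \<partial>\<rho>)"
        using that W_bounds \<open>c > 0\<close> by (intro nn_integral_eq_integral) auto
      also have "\<dots> = 1"
        using that \<open>c > 0\<close> by simp
      also have "(\<integral>\<^sup>+x. ennreal (W x / c) \<partial>\<rho>) = emeasure (density \<rho> (\<lambda>x. ennreal (W x / c))) (space \<rho>)"
        using sets_eq_imp_space_eq[OF that(1)]
        by (subst emeasure_density) (auto intro!: nn_integral_cong)
      finally have "prob_space (density \<rho> (\<lambda>x. ennreal (W x / c)))"
        by (intro prob_spaceI) simp
      then show ?thesis
        unfolding m_def
        by (intro prob_space.real_distribution_distr) (simp_all add: measurable_def)
    qed
    have lint: "(\<integral>y. f y \<partial>m \<rho>) = (\<integral>x. W x * f (x \<bullet> v) \<partial>\<rho>) / c"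
      if [simp, measurable_cong]: "sets \<rho> = sets borel" and [measurable]: "f \<in> borel_measurable borel" for \<rho> and f :: "real \<Rightarrow> real"
      unfolding m_def using W_bounds \<open>c > 0\<close>
      by (subst integral_distr) (simp_all add: integral_density field_simps)
    \<comment> \<open>The phases 0 and -pi/2 produce cosine and sine, so real phase-shifted cosines
      carry the whole characteristic function.\<close>
    have char_m: "char (m \<rho>) t = Complex ((\<integral>x. W x * cos (t * (x \<bullet> v) + 0) \<partial>\<rho>) / c)
        ((\<integral>x. W x * cos (t * (x \<bullet> v) + (- pi / 2)) \<partial>\<rho>) / c)"
      if [simp, measurable_cong]: "sets \<rho> = sets borel" and "real_distribution (m \<rho>)" for \<rho> t
    proof -
      interpret real_distribution "m \<rho>" by fact
      have i: "integrable (m \<rho>) (\<lambda>x. iexp (t * x))"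
        by (intro integrable_const_bound[of _ 1]) auto
      have "Re (char (m \<rho>) t) = (\<integral>y. cos (t * y) \<partial>m \<rho>)" "Im (char (m \<rho>) t) = (\<integral>y. sin (t * y) \<partial>m \<rho>)"
        unfolding char_def using i
        by (simp_all add: Re_exp Im_exp flip: integral_Re integral_Im)
      then show ?thesis
        by (simp add: lint complex_eq_iff cos_diff)
    qed
    have "m \<mu> = m \<nu>"
    proof (rule Levy_uniqueness)
      show 1: "real_distribution (m \<mu>)" "real_distribution (m \<nu>)"
        using \<open>prob_space \<mu>\<close> \<open>prob_space \<nu>\<close> int c_eq by (auto intro!: distribution simp: c_def)
      show "char (m \<mu>) = char (m \<nu>)"
        by (intro ext) (simp only: char_m sets 1 eq)
    qed
    then have "(\<integral>y. indicator A y \<partial>m \<mu>) = (\<integral>y. indicator A y \<partial>m \<nu> :: real)" by simp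
    then show ?thesis using \<open>c > 0\<close> by (simp add: lint del: Bochner_Integration.integral_indicator)
  qed
qed

text \<open>Conditioning one coordinate at a time: the class of weights \<open>f\<close> for which all integrals
  \<open>\<integral> f x cos (s \<bullet> x + c)\<close> agree is closed under multiplication by indicators of \<open>{x. x \<bullet> v \<in> A}\<close>,
  because \<open>f (1 + cos (s \<bullet> x + c))\<close> is again a nonnegative weight.\<close>

theorem measure_eq_if_cos_integrals_eq:
  fixes \<mu> \<nu> :: "'e::euclidean_space measure"
  assumes "prob_space \<mu>" "prob_space \<nu>"
    and sets [measurable_cong, simp]: "sets \<mu> = sets borel" "sets \<nu> = sets borel"
    and eq: "\<And>s c. (\<integral>x. cos (s \<bullet> x + c) \<partial>\<mu>) = (\<integral>x. cos (s \<bullet> x + c) \<partial>\<nu>)"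
  shows "\<mu> = \<nu>"
proof -
  interpret \<mu>: prob_space \<mu> by fact
  interpret \<nu>: prob_space \<nu> by fact
  have int: "integrable \<mu> f" "integrable \<nu> f" if "f \<in> borel_measurable borel" "\<And>x. \<bar>f x\<bar> \<le> 1" for f :: "'e \<Rightarrow> real"
    by (rule \<mu>.integrable_const_bound[of _ 1] \<nu>.integrable_const_bound[of _ 1]; use that in auto)+
  define same where "same f \<longleftrightarrow> (\<forall>s c. (\<integral>x. f x * cos (s \<bullet> x + c) \<partial>\<mu>) = (\<integral>x. f x * cos (s \<bullet> x + c) \<partial>\<nu>))" for f :: "'e \<Rightarrow> real"
  have step: "same (\<lambda>x. f x * indicator A (x \<bullet> v))"
    if f [measurable]: "f \<in> borel_measurable borel" and f_bounds: "\<And>x. 0 \<le> f x" "\<And>x. f x \<le> 1"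
      and same: "same f" and A [measurable]: "A \<in> sets borel" for f :: "'e \<Rightarrow> real" and A v
    unfolding same_def
  proof (intro allI)
    fix s c
    have bound: "\<bar>f x * y\<bar> \<le> 1" if "\<bar>y\<bar> \<le> 1" for x y
      using mult_mono[of "\<bar>f x\<bar>" 1 "\<bar>y\<bar>" 1] f_bounds[of x] that by (simp add: abs_mult)
    have bound': "\<bar>f x * indicator A (x \<bullet> v) * y\<bar> \<le> 1" if "\<bar>y\<bar> \<le> 1" for x y
      using bound[of y x] that by (auto simp: indicator_def)
    let ?W = "\<lambda>x. f x * (1 + cos (s \<bullet> x + c))"
    have W: "(\<integral>x. ?W x * indicator A (x \<bullet> v) \<partial>\<mu>) = (\<integral>x. ?W x * indicator A (x \<bullet> v) \<partial>\<nu>)"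
    proof (rule weighted_marginal_eq[where B = 2])
      show "0 \<le> ?W x" "?W x \<le> 2" for x
      proof -
        have "0 \<le> 1 + cos (s \<bullet> x + c)" "1 + cos (s \<bullet> x + c) \<le> 2"
          using cos_ge_minus_one[of "s \<bullet> x + c"] cos_le_one[of "s \<bullet> x + c"] by linarith+
        then show "0 \<le> ?W x" "?W x \<le> 2"
          using f_bounds[of x] mult_mono[of "f x" 1 "1 + cos (s \<bullet> x + c)" 2] by simp_all
      qed
      fix u d
      \<comment> \<open>Product-to-sum: the integral with weight \<open>?W\<close> in direction
        \<open>v\<close> splits into three integrals with weight \<open>f\<close>, in the directions
        u v, s + u v and s - u v, all covered by \<open>same f\<close>.\<close>
      have expand: "?W x * cos (u * (x \<bullet> v) + d) = f x * cos ((u *\<^sub>R v) \<bullet> x + d)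
          + (1/2) * (f x * cos ((s + u *\<^sub>R v) \<bullet> x + (c + d)))
          + (1/2) * (f x * cos ((s - u *\<^sub>R v) \<bullet> x + (c - d)))" for x
      proof -
        have "cos (s \<bullet> x + c) * cos (u * (x \<bullet> v) + d) =
          (1/2) * cos ((s - u *\<^sub>R v) \<bullet> x + (c - d)) + (1/2) * cos ((s + u *\<^sub>R v) \<bullet> x + (c + d))"
          by (subst cos_times_cos) (simp add: inner_simps inner_commute algebra_simps)
        then show ?thesis by (simp add: algebra_simps inner_commute)
      qed
      show "(\<integral>x. ?W x * cos (u * (x \<bullet> v) + d) \<partial>\<mu>) = (\<integral>x. ?W x * cos (u * (x \<bullet> v) + d) \<partial>\<nu>)"
        unfolding expand
        using same[unfolded same_def, rule_format, of "u *\<^sub>R v" d]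
          same[unfolded same_def, rule_format, of "s + u *\<^sub>R v" "c + d"]
          same[unfolded same_def, rule_format, of "s - u *\<^sub>R v" "c - d"] bound
        by (simp add: int del: inner_scaleR_left)
    qed (use assms in auto)
    have f: "(\<integral>x. f x * indicator A (x \<bullet> v) \<partial>\<mu>) = (\<integral>x. f x * indicator A (x \<bullet> v) \<partial>\<nu>)"
    proof (rule weighted_marginal_eq[where B = 1])
      show "(\<integral>x. f x * cos (u * (x \<bullet> v) + d) \<partial>\<mu>) = (\<integral>x. f x * cos (u * (x \<bullet> v) + d) \<partial>\<nu>)" for u d
        using same[unfolded same_def, rule_format, of "u *\<^sub>R v" d] by (simp add: inner_commute)
    qed (use assms f_bounds in auto)
    have split: "?W x * indicator A (x \<bullet> v) = f x * indicator A (x \<bullet> v) + f x * indicator A (x \<bullet> v) * cos (s \<bullet> x + c)" for x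
      by (simp add: algebra_simps)
    show "(\<integral>x. f x * indicator A (x \<bullet> v) * cos (s \<bullet> x + c) \<partial>\<mu>) = (\<integral>x. f x * indicator A (x \<bullet> v) * cos (s \<bullet> x + c) \<partial>\<nu>)"
      using W f bound' bound'[of 1] unfolding split
      by (simp add: int)
  qed
  have same_prod: "same (\<lambda>x. \<Prod>b\<in>S. indicator (A b) (x \<bullet> b))"
    if "finite S" "\<And>b. A b \<in> sets borel" for S and A :: "'e \<Rightarrow> real set"
    using that(1)
  proof induction
    case empty
    then show ?case using eq by (simp add: same_def)
  next
    case (insert b S)
    have [measurable]: "A b \<in> sets borel" for b by fact
    have "same (\<lambda>x. (\<Prod>b\<in>S. indicator (A b) (x \<bullet> b)) * indicator (A b) (x \<bullet> b))"
      using insert by (intro step) (auto intro!: prod_nonneg prod_le_1)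
    then show ?case using insert by (simp add: mult.commute)
  qed
  \<comment> \<open>The indicator of a box is a product of indicators in the coordinates;
    \<open>same_prod\<close> is used with zero frequency and zero phase.\<close>
  have box_eq: "emeasure \<mu> (box l u) = emeasure \<nu> (box l u)" for l u
  proof -
    have [simp]: "space \<mu> = UNIV" "space \<nu> = UNIV"
      using sets[THEN sets_eq_imp_space_eq] by simp_all
    have "(\<Prod>b\<in>Basis. indicator {l \<bullet> b<..<u \<bullet> b} (x \<bullet> b)) = (indicator (box l u) x :: real)" for x
      by (auto simp: indicator_def mem_box)
    then have "(\<integral>x. indicator (box l u) x \<partial>\<mu>) = (\<integral>x. indicator (box l u) x \<partial>\<nu> :: real)"
      using same_prod[of Basis "\<lambda>b. {l \<bullet> b<..<u \<bullet> b}"] unfolding same_def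
      by (auto dest!: spec[of _ 0])
    then show ?thesis
      by (simp add: \<mu>.emeasure_eq_measure \<nu>.emeasure_eq_measure)
  qed
  show ?thesis
  proof (rule measure_eqI_generator_eq)
    let ?E = "range (\<lambda>(a, b). box a b::'e set)"
    let ?A = "\<lambda>n::nat. box (- (real n *\<^sub>R One)) (real n *\<^sub>R One) :: 'e set"
    show "Int_stable ?E"
      by (auto simp: Int_stable_def box_Int_box)
    show "?E \<subseteq> Pow UNIV" "sets \<mu> = sigma_sets UNIV ?E" "sets \<nu> = sigma_sets UNIV ?E"
      by (simp_all add: borel_eq_box)
    show "range ?A \<subseteq> ?E" "(\<Union>i. ?A i) = UNIV"
      unfolding UN_box_eq_UNIV by auto
    show "emeasure \<mu> (?A i) \<noteq> \<infinity>" for i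
      by simp
  qed (auto simp: box_eq)
qed

section \<open>Fixed points of random causal maps\<close>

text \<open>Rounding is done coordinate by coordinate, so points sharing some coordinates still
  share them afterwards. \<open>Suc n\<close> keeps the mesh well defined at
  \<open>n = 0\<close>.\<close>

definition grid_round :: "nat \<Rightarrow> 'e::euclidean_space \<Rightarrow> 'e" where
  "grid_round n x = (\<Sum>b\<in>Basis. (of_int \<lfloor>real (Suc n) * (x \<bullet> b)\<rfloor> / real (Suc n)) *\<^sub>R b)"

lemma grid_round_inner [simp]:
  "b \<in> Basis \<Longrightarrow> grid_round n x \<bullet> b = of_int \<lfloor>real (Suc n) * (x \<bullet> b)\<rfloor> / real (Suc n)"
  by (simp add: grid_round_def)

lemma countable_range_grid_round: "countable (range (grid_round n :: 'e::euclidean_space \<Rightarrow> 'e))"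
proof -
  have "grid_round n x \<in> (\<lambda>f. \<Sum>b\<in>Basis. f b *\<^sub>R b) ` (Basis \<rightarrow>\<^sub>E \<rat>)" for x :: 'e
  proof
    show "grid_round n x = (\<Sum>b\<in>Basis. restrict (\<lambda>b. of_int \<lfloor>real (Suc n) * (x \<bullet> b)\<rfloor> / real (Suc n)) Basis b *\<^sub>R b)"
      unfolding grid_round_def by (intro sum.cong) simp_all
  qed (auto intro!: Rats_divide simp del: of_nat_Suc)
  moreover have "countable ((\<lambda>f. \<Sum>b\<in>Basis. f b *\<^sub>R b :: 'e) ` (Basis \<rightarrow>\<^sub>E \<rat>))"
    by (intro countable_image countable_PiE countable_rat) auto
  ultimately show ?thesis
    by (meson countable_subset image_subsetI)
qed

lemma measurable_grid_round [measurable]: "grid_round n \<in> borel_measurable borel"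
  unfolding grid_round_def by measurable

lemma norm_grid_round_diff: "norm (grid_round n x - x) \<le> DIM('e) / real (Suc n)"
  for x :: "'e::euclidean_space"
proof -
  have "norm (grid_round n x - x) \<le> (\<Sum>b\<in>Basis. \<bar>(grid_round n x - x) \<bullet> b\<bar>)"
    by (rule norm_le_l1)
  also have "\<dots> \<le> (\<Sum>b\<in>(Basis::'e set). 1 / real (Suc n))"
  proof (rule sum_mono)
    fix b :: 'e assume b: "b \<in> Basis"
    have "\<bar>of_int \<lfloor>real (Suc n) * (x \<bullet> b)\<rfloor> - real (Suc n) * (x \<bullet> b)\<bar> \<le> 1" by linarith
    then have "\<bar>of_int \<lfloor>real (Suc n) * (x \<bullet> b)\<rfloor> - real (Suc n) * (x \<bullet> b)\<bar> / real (Suc n) \<le> 1 / real (Suc n)"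
      by (rule divide_right_mono) simp
    also have "\<bar>of_int \<lfloor>real (Suc n) * (x \<bullet> b)\<rfloor> - real (Suc n) * (x \<bullet> b)\<bar> / real (Suc n) = \<bar>(grid_round n x - x) \<bullet> b\<bar>"
      using b by (simp add: inner_diff_left abs_divide field_simps del: of_nat_Suc)
    finally show "\<bar>(grid_round n x - x) \<bullet> b\<bar> \<le> 1 / real (Suc n)" .
  qed
  finally show ?thesis by simp
qed

lemma grid_round_tendsto:
  fixes x :: "nat \<Rightarrow> 'e::euclidean_space"
  assumes "x \<longlonglongrightarrow> l"
  shows "(\<lambda>n. grid_round n (x n)) \<longlonglongrightarrow> l"
proof -
  have "(\<lambda>n. grid_round n (x n) - x n) \<longlonglongrightarrow> 0"
  proof (rule Lim_null_comparison)
    show "\<forall>\<^sub>F n in sequentially. norm (grid_round n (x n) - x n) \<le> DIM('e) / real (Suc n)"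
      by (simp add: norm_grid_round_diff del: of_nat_Suc)
    show "(\<lambda>n. DIM('e) / real (Suc n)) \<longlonglongrightarrow> 0"
      using LIMSEQ_Suc[OF lim_const_over_n[of "real DIM('e)"]] by simp
  qed
  from tendsto_add[OF this assms] show ?thesis by simp
qed

text \<open>\<open>agree k x y\<close> says that the first \<open>k\<close> stages of \<open>x\<close> and \<open>y\<close> coincide; a causal map
  determines one more stage than it reads.\<close>

definition causal :: "(nat \<Rightarrow> 'e \<Rightarrow> 'e \<Rightarrow> bool) \<Rightarrow> ('e \<Rightarrow> 'e) \<Rightarrow> bool" where
  "causal agree g \<longleftrightarrow> (\<forall>k x y. agree k x y \<longrightarrow> agree (Suc k) (g x) (g y))"

text \<open>The three axioms are the base of the induction over stages, its end after
  \<open>K\<close> stages, and the compatibility that keeps a causal map causal after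
  rounding.\<close>

locale staged_space =
  fixes agree :: "nat \<Rightarrow> 'e::euclidean_space \<Rightarrow> 'e \<Rightarrow> bool" and K :: nat
  assumes agree_0: "agree 0 x y"
    and agree_K: "agree K x y \<Longrightarrow> x = y"
    and agree_grid_round: "agree k x y \<Longrightarrow> agree k (grid_round n x) (grid_round n y)"
begin

text \<open>Each application settles one more stage irrespective of the start, so \<open>K\<close>
  applications forget the start completely.\<close>

lemma causal_funpow_eq:
  assumes "causal agree g"
  shows "(g ^^ K) x = (g ^^ K) y"
proof -
  have "agree k ((g ^^ k) x) ((g ^^ k) y)" for k
    by (induction k) (use assms agree_0 in \<open>auto simp: causal_def\<close>)
  then show ?thesis by (rule agree_K)
qed

text \<open>Existence and uniqueness at once; the start 0 of the iteration is arbitrary. It is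
  applied both to the original map and to the rounded one.\<close>

lemma causal_fixpoint_iff:
  assumes "causal agree g"
  shows "g x = x \<longleftrightarrow> x = (g ^^ K) 0"
proof
  assume "g x = x"
  then have "(g ^^ k) x = x" for k
    by (induction k) simp_all
  from this[of K] show "x = (g ^^ K) 0"
    using causal_funpow_eq[OF assms, of x 0] by simp
next
  \<comment> \<open>Applying \<open>g\<close> once more amounts to starting the same iteration at
    \<open>g 0\<close>, and the start is forgotten.\<close>
  have "g ((g ^^ K) 0) = (g ^^ K) (g 0)"
    by (simp add: funpow_swap1)
  also have "\<dots> = (g ^^ K) 0"
    by (rule causal_funpow_eq[OF assms])
  finally show "g x = x" if "x = (g ^^ K) 0" using that by simp
qed

lemma causal_grid_round: "causal agree g \<Longrightarrow> causal agree (\<lambda>x. grid_round n (g x))"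
  by (simp add: causal_def agree_grid_round)

end

lemma grid_round_funpow_tendsto:
  fixes g :: "'e::euclidean_space \<Rightarrow> 'e"
  assumes "continuous_on UNIV g"
  shows "(\<lambda>n. ((\<lambda>x. grid_round n (g x)) ^^ k) 0) \<longlonglongrightarrow> (g ^^ k) 0"
proof (induction k)
  case (Suc k)
  then show ?case
    using assms by (auto intro!: grid_round_tendsto isCont_tendsto_compose[of _ g] simp: continuous_on_eq_continuous_at)
qed simp

text \<open>\<open>g w x\<close> is measurable in \<open>w\<close> only for each fixed
  \<open>x\<close>, so inserting a random point needs an argument: the inserted iterate has
  countably many values, and one can split over them.\<close>

lemma measurable_grid_round_funpow:
  fixes g :: "'a \<Rightarrow> 'e::euclidean_space \<Rightarrow> 'e"
  assumes [measurable]: "\<And>x. (\<lambda>w. g w x) \<in> borel_measurable M"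
  shows "(\<lambda>w. ((\<lambda>x. grid_round n (g w x)) ^^ k) 0) \<in> borel_measurable M"
proof (induction k)
  case (Suc k)
  let ?X = "\<lambda>w. ((\<lambda>x. grid_round n (g w x)) ^^ k) 0"
  have [measurable]: "?X \<in> M \<rightarrow>\<^sub>M borel" by fact
  have "?X w \<in> insert 0 (range (grid_round n))" for w
    by (cases k) auto
  moreover have c: "countable (insert 0 (range (grid_round n :: 'e \<Rightarrow> 'e)))"
    by (simp add: countable_range_grid_round)
  ultimately have [measurable]: "?X \<in> M \<rightarrow>\<^sub>M count_space (insert 0 (range (grid_round n)))"
    by (subst measurable_count_space_eq_countable) (auto simp: space_def[symmetric])
  have "(\<lambda>w. grid_round n (g w (?X w))) \<in> borel_measurable M"
    by (rule measurable_compose_countable'[OF _ _ c]) measurable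
  then show ?case by simp
qed simp

context staged_space begin

text \<open>Pointwise limit of the rounded iterates, whose measurability comes from their countable
  range.\<close>

lemma measurable_causal_funpow:
  fixes g :: "'a \<Rightarrow> 'e \<Rightarrow> 'e"
  assumes "\<And>w. w \<in> space M \<Longrightarrow> continuous_on UNIV (g w)"
    and "\<And>x. (\<lambda>w. g w x) \<in> borel_measurable M"
  shows "(\<lambda>w. (g w ^^ k) 0) \<in> borel_measurable M"
  by (rule borel_measurable_LIMSEQ_metric[OF measurable_grid_round_funpow grid_round_funpow_tendsto])
    (use assms in auto)

text \<open>The rounded iteration has countably many values, and it equals \<open>y\<close> exactly when
  \<open>g w y\<close> rounds to \<open>y\<close>, so its law only involves the laws of \<open>g w y\<close> at fixed \<open>y\<close>.\<close>

lemma distr_grid_round_funpow_eq: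
  fixes g h :: "'a \<Rightarrow> 'e \<Rightarrow> 'e"
  assumes causal: "\<And>w. w \<in> space M \<Longrightarrow> causal agree (g w)" "\<And>w. w \<in> space M \<Longrightarrow> causal agree (h w)"
    and [measurable]: "\<And>x. (\<lambda>w. g w x) \<in> borel_measurable M" "\<And>x. (\<lambda>w. h w x) \<in> borel_measurable M"
    and eq: "\<And>x. distr M borel (\<lambda>w. g w x) = distr M borel (\<lambda>w. h w x)"
    and A: "A \<in> sets borel"
  defines "X \<equiv> \<lambda>n g w. ((\<lambda>x. grid_round n (g w x)) ^^ K) 0"
  shows "emeasure M (X n g -` A \<inter> space M) = emeasure M (X n h -` A \<inter> space M)"
proof -
  define C where "C = insert 0 (range (grid_round n :: 'e \<Rightarrow> 'e))"
  have C: "countable C"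
    by (simp add: C_def countable_range_grid_round)
  have vals: "X n f w \<in> C" for f w
    unfolding X_def C_def by (cases K) auto
  have split: "emeasure M (X n f -` A \<inter> space M) =
      (\<integral>\<^sup>+y. emeasure M ((\<lambda>w. grid_round n (f w y)) -` {y} \<inter> space M) \<partial>count_space (C \<inter> A))"
    if c: "\<And>w. w \<in> space M \<Longrightarrow> causal agree (f w)" and [measurable]: "\<And>x. (\<lambda>w. f w x) \<in> borel_measurable M" for f
  proof -
    have fiber: "(\<lambda>w. grid_round n (f w y)) -` {y} \<inter> space M = X n f -` {y} \<inter> space M" for y
      using causal_fixpoint_iff[OF causal_grid_round[OF c], of _ n y] by (auto simp: X_def)
    have "X n f -` A \<inter> space M = (\<Union>y\<in>C \<inter> A. (\<lambda>w. grid_round n (f w y)) -` {y} \<inter> space M)"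
      using vals[of f] by (auto simp: fiber)
    also have "emeasure M \<dots> = (\<integral>\<^sup>+y. emeasure M ((\<lambda>w. grid_round n (f w y)) -` {y} \<inter> space M) \<partial>count_space (C \<inter> A))"
    proof (rule emeasure_UN_countable)
      show "disjoint_family_on (\<lambda>y. (\<lambda>w. grid_round n (f w y)) -` {y} \<inter> space M) (C \<inter> A)"
        unfolding disjoint_family_on_def fiber by blast
    qed (use C in auto)
    finally show ?thesis .
  qed
  \<comment> \<open>The only comparison between \<open>g\<close> and \<open>h\<close>, and it takes
    place at one fixed \<open>y\<close>.\<close>
  have "emeasure M ((\<lambda>w. grid_round n (g w y)) -` {y} \<inter> space M) =
      emeasure M ((\<lambda>w. grid_round n (h w y)) -` {y} \<inter> space M)" for y
  proof -
    have "emeasure (distr M borel (\<lambda>w. f w y)) (grid_round n -` {y} \<inter> space borel) =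
      emeasure M ((\<lambda>w. grid_round n (f w y)) -` {y} \<inter> space M)" if [measurable]: "\<And>x. (\<lambda>w. f w x) \<in> borel_measurable M" for f
      using measurable_sets[OF measurable_grid_round, of "{y}" n]
      by (subst emeasure_distr) (auto intro!: arg_cong[where f = "emeasure M"])
    from this[of g] this[of h] show ?thesis using eq[of y] by simp
  qed
  then show ?thesis
    using causal by (simp add: split cong: nn_integral_cong)
qed

text \<open>The rounded solutions have equal laws for every mesh and converge pointwise to the true
  ones. Cosines are bounded and continuous, so their integrals pass to the limit by dominated
  convergence, and they determine the law.\<close>

theorem distr_causal_fixpoint_eq:
  fixes g h :: "'a \<Rightarrow> 'e \<Rightarrow> 'e"
  assumes "prob_space M"
    and causal: "\<And>w. w \<in> space M \<Longrightarrow> causal agree (g w)" "\<And>w. w \<in> space M \<Longrightarrow> causal agree (h w)"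
    and cont: "\<And>w. w \<in> space M \<Longrightarrow> continuous_on UNIV (g w)" "\<And>w. w \<in> space M \<Longrightarrow> continuous_on UNIV (h w)"
    and meas [measurable]: "\<And>x. (\<lambda>w. g w x) \<in> borel_measurable M" "\<And>x. (\<lambda>w. h w x) \<in> borel_measurable M"
    and eq: "\<And>x. distr M borel (\<lambda>w. g w x) = distr M borel (\<lambda>w. h w x)"
  shows "distr M borel (\<lambda>w. (g w ^^ K) 0) = distr M borel (\<lambda>w. (h w ^^ K) 0)"
proof -
  interpret prob_space M by fact
  have [measurable]: "(\<lambda>w. (g w ^^ K) 0) \<in> borel_measurable M" "(\<lambda>w. (h w ^^ K) 0) \<in> borel_measurable M"
    by (intro measurable_causal_funpow cont meas; assumption)+
  define X where "X = (\<lambda>n (g :: 'a \<Rightarrow> 'e \<Rightarrow> 'e) w. ((\<lambda>x. grid_round n (g w x)) ^^ K) 0)"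
  have X_meas: "X n g \<in> borel_measurable M" "X n h \<in> borel_measurable M" for n
    unfolding X_def by (rule measurable_grid_round_funpow; fact)+
  have X_eq: "distr M borel (X n g) = distr M borel (X n h)" for n
    using distr_grid_round_funpow_eq[OF causal meas eq, of _ n]
    by (intro measure_eqI) (simp_all add: emeasure_distr X_meas, simp add: X_def)
  show ?thesis
  proof (rule measure_eq_if_cos_integrals_eq)
    fix s :: 'e and c
    have lim: "(\<lambda>n. \<integral>w. cos (s \<bullet> X n f w + c) \<partial>M) \<longlonglongrightarrow> (\<integral>w. cos (s \<bullet> (f w ^^ K) 0 + c) \<partial>M)"
      if f: "\<And>w. w \<in> space M \<Longrightarrow> continuous_on UNIV (f w)" and [measurable]: "\<And>x. (\<lambda>w. f w x) \<in> borel_measurable M" for f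
    proof (rule integral_dominated_convergence[where w = "\<lambda>_. 1"])
      have [measurable]: "X n f \<in> borel_measurable M" for n
        unfolding X_def by (rule measurable_grid_round_funpow) fact
      show "(\<lambda>w. cos (s \<bullet> X n f w + c)) \<in> borel_measurable M" for n
        by measurable
      have [measurable]: "(\<lambda>w. (f w ^^ K) 0) \<in> borel_measurable M"
        by (intro measurable_causal_funpow f; simp)
      show "(\<lambda>w. cos (s \<bullet> (f w ^^ K) 0 + c)) \<in> borel_measurable M"
        by measurable
      show "AE w in M. (\<lambda>n. cos (s \<bullet> X n f w + c)) \<longlonglongrightarrow> cos (s \<bullet> (f w ^^ K) 0 + c)"
        unfolding X_def using f
        by (auto intro!: tendsto_intros grid_round_funpow_tendsto)
    qed auto
    have "(\<integral>w. cos (s \<bullet> X n f w + c) \<partial>M) = (\<integral>x. cos (s \<bullet> x + c) \<partial>distr M borel (X n f))" if "X n f \<in> borel_measurable M" for n f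
      using that by (subst integral_distr) auto
    then have "(\<integral>w. cos (s \<bullet> X n g w + c) \<partial>M) = (\<integral>w. cos (s \<bullet> X n h w + c) \<partial>M)" for n
      by (simp add: X_meas X_eq)
    then have "(\<integral>w. cos (s \<bullet> (g w ^^ K) 0 + c) \<partial>M) = (\<integral>w. cos (s \<bullet> (h w ^^ K) 0 + c) \<partial>M)"
      using lim[OF cont(1) meas(1)] lim[OF cont(2) meas(2)] by (simp add: LIMSEQ_unique)
    then show "(\<integral>x. cos (s \<bullet> x + c) \<partial>distr M borel (\<lambda>w. (g w ^^ K) 0)) = (\<integral>x. cos (s \<bullet> x + c) \<partial>distr M borel (\<lambda>w. (h w ^^ K) 0))"
      by (subst (1 2) integral_distr) auto
  qed (auto intro!: prob_space_distr)
qed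

end

section \<open>Block matrices\<close>

text \<open>The inner product of matrices is the trace of \<open>transpose A ** B\<close>; the
  adjoint of left multiplication is left multiplication by the transpose.\<close>

lemma inner_matrix_mult_left: "(A ** B) \<bullet> C = B \<bullet> (transpose A ** C)"
  for A :: "real ^ 'k ^ 'n" and B :: "real ^ 'p ^ 'k" and C :: "real ^ 'p ^ 'n"
proof -
  have "(A ** B) \<bullet> C = (\<Sum>a\<in>UNIV. \<Sum>p\<in>UNIV. \<Sum>k\<in>UNIV. A $ a $ k * B $ k $ p * C $ a $ p)"
    by (simp add: inner_vec_def matrix_matrix_mult_def sum_distrib_right)
  also have "\<dots> = (\<Sum>a\<in>UNIV. \<Sum>k\<in>UNIV. \<Sum>p\<in>UNIV. A $ a $ k * B $ k $ p * C $ a $ p)"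
    by (intro sum.cong refl sum.swap)
  also have "\<dots> = (\<Sum>k\<in>UNIV. \<Sum>a\<in>UNIV. \<Sum>p\<in>UNIV. A $ a $ k * B $ k $ p * C $ a $ p)"
    by (rule sum.swap)
  also have "\<dots> = (\<Sum>k\<in>UNIV. \<Sum>p\<in>UNIV. \<Sum>a\<in>UNIV. A $ a $ k * B $ k $ p * C $ a $ p)"
    by (intro sum.cong refl sum.swap)
  also have "\<dots> = B \<bullet> (transpose A ** C)"
    by (simp add: inner_vec_def matrix_matrix_mult_def transpose_def sum_distrib_left mult_ac)
  finally show ?thesis .
qed

lemma inner_transpose_transpose: "transpose A \<bullet> transpose B = A \<bullet> B"
  for A B :: "real ^ 'k ^ 'n"
  by (simp add: inner_vec_def transpose_def) (rule sum.swap)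

lemma inner_matrix_mult_right: "(A ** B) \<bullet> C = A \<bullet> (C ** transpose B)"
  for A :: "real ^ 'k ^ 'n" and B :: "real ^ 'p ^ 'k" and C :: "real ^ 'p ^ 'n"
proof -
  have "(A ** B) \<bullet> C = (transpose B ** transpose A) \<bullet> transpose C"
    by (simp flip: inner_transpose_transpose[of _ C] add: matrix_transpose_mul)
  also have "\<dots> = transpose A \<bullet> (B ** transpose C)"
    by (simp add: inner_matrix_mult_left)
  also have "\<dots> = A \<bullet> (C ** transpose B)"
    by (simp flip: inner_transpose_transpose[of A] add: matrix_transpose_mul)
  finally show ?thesis .
qed

lemma matrix_scaleR_left: "(c *\<^sub>R A) ** B = c *\<^sub>R (A ** B)"
  for A :: "real ^ 'k ^ 'n" and B :: "real ^ 'p ^ 'k"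
  by (simp add: matrix_matrix_mult_def vec_eq_iff sum_distrib_left mult.assoc)

lemma matrix_scaleR_right: "A ** (c *\<^sub>R B) = c *\<^sub>R (A ** B)"
  for A :: "real ^ 'k ^ 'n" and B :: "real ^ 'p ^ 'k"
  by (simp add: matrix_matrix_mult_def vec_eq_iff sum_distrib_left mult_ac)

lemma transpose_add: "transpose (A + B) = transpose A + transpose B"
  for A B :: "real ^ 'k ^ 'n"
  by (simp add: transpose_def vec_eq_iff)

lemma matrix_diff_rdistrib: "(A - B) ** C = A ** C - B ** C"
  for A B :: "real ^ 'k ^ 'n" and C :: "real ^ 'p ^ 'k"
  by (simp add: matrix_matrix_mult_def vec_eq_iff sum_subtractf left_diff_distrib)

lemma matrix_diff_ldistrib: "A ** (B - C) = A ** B - A ** C"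
  for A :: "real ^ 'k ^ 'n" and B C :: "real ^ 'p ^ 'k"
  by (simp add: matrix_matrix_mult_def vec_eq_iff sum_subtractf right_diff_distrib)

text \<open>Taking the upper part is an orthogonal projection onto a coordinate subspace, hence
  self-adjoint.\<close>

lemma inner_upper_part: "upper_part E \<bullet> F = E \<bullet> upper_part F"
  by (simp add: inner_vec_def upper_part_def if_distrib if_distribR cong: if_cong)

lemma inner_strict_upper_part: "strict_upper_part E \<bullet> F = E \<bullet> strict_upper_part F"
  by (simp add: inner_vec_def strict_upper_part_def if_distrib if_distribR cong: if_cong)

lemma block_upper_triangularD: "block_upper_triangular E \<Longrightarrow> fst b < fst a \<Longrightarrow> E $ a $ b = 0"
  unfolding block_upper_triangular_def by blast

lemma block_upper_triangular_upper_part: "block_upper_triangular (upper_part E)"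
  by (auto simp: block_upper_triangular_def upper_part_def)

lemma inner_eq_0_if_disjoint_support:
  fixes E F :: "real ^ 'k ^ 'n"
  assumes "\<And>a b. E $ a $ b = 0 \<or> F $ a $ b = 0"
  shows "E \<bullet> F = 0"
  unfolding inner_vec_def using assms by (auto intro!: sum.neutral)

text \<open>The diagonal blocks are kept by only one of the two parts, so the supports are disjoint.
  This removes the mixed term in the variance of the \<open>W\<close> noise.\<close>

lemma inner_upper_transpose_strict_upper:
  "upper_part E \<bullet> transpose (strict_upper_part F) = 0"
  by (rule inner_eq_0_if_disjoint_support)
    (auto simp: upper_part_def strict_upper_part_def transpose_def)

lemma inner_strict_lower_upper:
  assumes A: "block_upper_triangular A" and B: "block_upper_triangular B"
  shows "((X - upper_part X) ** transpose B) \<bullet> (A ** transpose (Y - strict_upper_part Y)) = 0"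
proof (rule inner_eq_0_if_disjoint_support)
  fix a d
  show "((X - upper_part X) ** transpose B) $ a $ d = 0 \<or> (A ** transpose (Y - strict_upper_part Y)) $ a $ d = 0"
  \<comment> \<open>Strictly below the block diagonal the second matrix vanishes; elsewhere the
    first does.\<close>
  proof (cases "fst d < fst a")
    case True
    have "A $ a $ b * (Y - strict_upper_part Y) $ d $ b = 0" for b
      using A True by (cases "fst b < fst a")
        (auto simp: block_upper_triangularD strict_upper_part_def)
    then show ?thesis
      by (intro disjI2) (auto simp: matrix_matrix_mult_def transpose_def intro!: sum.neutral)
  next
    case False
    have "(X - upper_part X) $ a $ b * B $ d $ b = 0" for b
      using B False by (cases "fst b < fst d")
        (auto simp: block_upper_triangularD upper_part_def)
    then show ?thesis
      by (intro disjI1) (auto simp: matrix_matrix_mult_def transpose_def intro!: sum.neutral)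
  qed
qed

text \<open>The norm of \<open>P ** transpose B\<close> depends on \<open>B\<close> only through
  \<open>transpose B ** B\<close>, so in the variances a Cholesky factor can be traded for the
  overlap it factors.\<close>

lemma inner_gram_right:
  fixes P :: "real ^ 'k ^ 'n" and E :: "real ^ 'k ^ 'm"
  assumes "transpose B ** B = c *\<^sub>R (transpose E ** E) + s *\<^sub>R mat 1"
  shows "(P ** transpose B) \<bullet> (P ** transpose B) =
    c * ((P ** transpose E) \<bullet> (P ** transpose E)) + s * (P \<bullet> P)"
  using assms
  by (simp add: inner_matrix_mult_right[of P] matrix_add_ldistrib matrix_scaleR_right
      inner_add_right flip: matrix_mul_assoc)

lemma inner_gram_left:
  fixes P :: "real ^ 'n ^ 'k" and E :: "real ^ 'k ^ 'm"
  assumes "transpose A ** A = c *\<^sub>R (transpose E ** E) + s *\<^sub>R mat 1"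
  shows "(A ** P) \<bullet> (A ** P) = c * ((E ** P) \<bullet> (E ** P)) + s * (P \<bullet> P)"
  using inner_gram_right[OF assms, of "transpose P"]
  by (simp add: inner_transpose_transpose flip: matrix_transpose_mul)

text \<open>Per label \<open>\<zeta>\<close>, with \<open>A = A\<^sub>\<theta>\<close>, \<open>B = A\<^sub>\<omega>\<close>, \<open>c = 1/m\<close>, \<open>s = \<sigma>\<^sup>2\<close>, the coefficients of \<open>G\<close>, \<open>H\<close>, \<open>W\<close> on the left and those of
  the samples, \<open>U\<close>, \<open>V\<close>, \<open>\<Gamma>\<close> on the right. The mixed terms match because \<open>(X - X\<^sub>u) B\<^sup>T\<close> is strictly
  block lower triangular and \<open>A (Y - Y\<^sub>U)\<^sup>T\<close> is block upper triangular.\<close>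

lemma variance_identity:
  fixes S \<Theta> :: "real ^ ('l::{finite,linorder} \<times> 'j::finite) ^ 'n" and T \<Omega> :: "real ^ ('l \<times> 'j) ^ 'm"
    and R R\<^sub>h :: "real ^ 'n ^ 'n" and A B X Y :: "('l, 'j) sqblock" and c s :: real
  assumes R: "transpose R\<^sub>h = R\<^sub>h" "R\<^sub>h ** R\<^sub>h = R"
    and A: "block_upper_triangular A" "transpose A ** A = transpose \<Theta> ** R ** \<Theta> + s *\<^sub>R mat 1"
    and B: "block_upper_triangular B" "transpose B ** B = c *\<^sub>R (transpose \<Omega> ** \<Omega>) + s *\<^sub>R mat 1"
    and X: "transpose A ** X = transpose \<Theta> ** R ** S"
    and Y: "transpose B ** Y = transpose \<Omega> ** T"
  defines "U \<equiv> upper_part X" and "L \<equiv> transpose (strict_upper_part Y)"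
  defines "E \<equiv> R\<^sub>h ** S ** transpose B + R\<^sub>h ** \<Theta> ** L"
    and "F \<equiv> T ** transpose A + c *\<^sub>R (\<Omega> ** transpose U)"
    and "C \<equiv> c *\<^sub>R (S ** transpose \<Omega>) + \<Theta> ** transpose T"
    and "G \<equiv> U ** transpose B + A ** L"
  shows "c * (E \<bullet> E) + F \<bullet> F + c * s * ((U + L) \<bullet> (U + L)) =
    C \<bullet> (R ** C) + c * s * ((R\<^sub>h ** S) \<bullet> (R\<^sub>h ** S)) + s * (T \<bullet> T) + c * (G \<bullet> G)"
proof -
  have adj: "(R\<^sub>h ** P) \<bullet> (R\<^sub>h ** Q) = P \<bullet> (R ** Q)" for P Q :: "real ^ 'k ^ 'n"
    by (simp add: inner_matrix_mult_left R matrix_mul_assoc)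
  have RT: "transpose R = R"
    using R by (metis matrix_transpose_mul)
  \<comment> \<open>The root puts \<open>R\<close> inside the Gram matrix, so that
    \<open>inner_gram_left\<close> applies with constant 1.\<close>
  have A': "transpose A ** A = 1 *\<^sub>R (transpose (R\<^sub>h ** \<Theta>) ** (R\<^sub>h ** \<Theta>)) + s *\<^sub>R mat 1"
    using A(2) R(1) by (simp add: matrix_transpose_mul matrix_mul_assoc flip: R(2))
  \<comment> \<open>The mixed terms on the left: \<open>t2\<close> comes from
    \<open>E \<bullet> E\<close> and \<open>t1\<close> from \<open>F \<bullet> F\<close>. Those on
    the right come from \<open>C\<close> (\<open>c3\<close>) and from \<open>G\<close>.\<close>
  define t1 where "t1 = (U ** transpose B) \<bullet> (A ** transpose Y)"
  define t2 where "t2 = (X ** transpose B) \<bullet> (A ** L)"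
  have c1: "(R\<^sub>h ** S ** transpose B) \<bullet> (R\<^sub>h ** \<Theta> ** L) = t2"
  proof -
    have "(R\<^sub>h ** S ** transpose B) \<bullet> (R\<^sub>h ** \<Theta> ** L) = (R\<^sub>h ** (\<Theta> ** L)) \<bullet> (R\<^sub>h ** (S ** transpose B))"
      by (simp add: inner_commute matrix_mul_assoc)
    also have "\<dots> = L \<bullet> (transpose \<Theta> ** R ** S ** transpose B)"
      unfolding adj by (simp add: inner_matrix_mult_left matrix_mul_assoc)
    also have "\<dots> = L \<bullet> (transpose A ** (X ** transpose B))"
      by (simp add: matrix_mul_assoc X)
    also have "\<dots> = t2"
      by (simp add: t2_def inner_commute inner_matrix_mult_left[of A])
    finally show ?thesis .
  qed
  have c2: "(T ** transpose A) \<bullet> (\<Omega> ** transpose U) = t1"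
  proof -
    have "(T ** transpose A) \<bullet> (\<Omega> ** transpose U) = transpose U \<bullet> (transpose \<Omega> ** T ** transpose A)"
      by (subst inner_commute) (simp add: inner_matrix_mult_left matrix_mul_assoc)
    also have "\<dots> = transpose U \<bullet> (transpose B ** (Y ** transpose A))"
      by (simp add: matrix_mul_assoc Y)
    also have "\<dots> = (B ** transpose U) \<bullet> (Y ** transpose A)"
      by (simp add: inner_matrix_mult_left)
    also have "\<dots> = transpose (U ** transpose B) \<bullet> transpose (A ** transpose Y)"
      by (simp add: matrix_transpose_mul)
    finally show ?thesis
      by (simp add: t1_def inner_transpose_transpose)
  qed
  have c3: "(S ** transpose \<Omega>) \<bullet> (R ** (\<Theta> ** transpose T)) = (X ** transpose B) \<bullet> (A ** transpose Y)"
  proof -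
    have "(S ** transpose \<Omega>) \<bullet> (R ** (\<Theta> ** transpose T)) =
        transpose T \<bullet> (transpose \<Theta> ** R ** S ** transpose \<Omega>)"
      by (subst inner_commute) (simp add: inner_matrix_mult_left matrix_mul_assoc matrix_transpose_mul RT)
    also have "\<dots> = (transpose A ** X ** transpose \<Omega>) \<bullet> transpose T"
      by (simp add: X inner_commute)
    also have "\<dots> = (transpose A ** X) \<bullet> transpose (transpose \<Omega> ** T)"
      by (simp add: inner_matrix_mult_right[of _ "transpose \<Omega>"] matrix_transpose_mul)
    also have "\<dots> = (transpose A ** X ** transpose B) \<bullet> transpose Y"
      by (simp add: inner_matrix_mult_right[of _ "transpose B"] matrix_transpose_mul flip: Y)
    also have "\<dots> = (X ** transpose B) \<bullet> (A ** transpose Y)"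
      by (simp add: inner_matrix_mult_left[of "transpose A"] flip: matrix_mul_assoc)
    finally show ?thesis .
  qed
  \<comment> \<open>This is the expansion of \<open>((X - U) ** transpose B) \<bullet> (A **
    (transpose Y - L)) = 0\<close>.\<close>
  have c4: "t1 + t2 = (X ** transpose B) \<bullet> (A ** transpose Y) + (U ** transpose B) \<bullet> (A ** L)"
  proof -
    have "transpose (Y - strict_upper_part Y) = transpose Y - L"
      by (simp add: L_def transpose_def vec_eq_iff)
    then show ?thesis
      using inner_strict_lower_upper[OF A(1) B(1), of X Y] unfolding t1_def t2_def U_def[symmetric]
      by (simp add: matrix_diff_rdistrib matrix_diff_ldistrib inner_diff_left inner_diff_right)
  qed
  have c5: "U \<bullet> L = 0"
    unfolding U_def L_def by (rule inner_upper_transpose_strict_upper)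
  \<comment> \<open>Pure terms: \<open>n1\<close> and \<open>n2\<close> turn the S part of
    \<open>E\<close> and the T part of \<open>F\<close> into the pure terms of \<open>C\<close> plus
    the variances of the U and V noise. \<open>n3\<close> and \<open>n4\<close> show that the two
    parts of \<open>G\<close> absorb the remaining terms of \<open>E\<close>, \<open>F\<close> and
    \<open>U + L\<close>.\<close>
  have n1: "(R\<^sub>h ** S ** transpose B) \<bullet> (R\<^sub>h ** S ** transpose B) =
      c * ((S ** transpose \<Omega>) \<bullet> (R ** (S ** transpose \<Omega>))) + s * ((R\<^sub>h ** S) \<bullet> (R\<^sub>h ** S))"
    unfolding inner_gram_right[OF B(2)] by (simp flip: matrix_mul_assoc add: adj)
  have n2: "(T ** transpose A) \<bullet> (T ** transpose A) = (\<Theta> ** transpose T) \<bullet> (R ** (\<Theta> ** transpose T)) + s * (T \<bullet> T)"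
  proof -
    have "(T ** transpose A) \<bullet> (T ** transpose A) = (A ** transpose T) \<bullet> (A ** transpose T)"
      by (subst inner_transpose_transpose[symmetric]) (simp add: matrix_transpose_mul)
    also have "\<dots> = (\<Theta> ** transpose T) \<bullet> (R ** (\<Theta> ** transpose T)) + s * (T \<bullet> T)"
      unfolding inner_gram_left[OF A'] by (simp flip: matrix_mul_assoc add: adj inner_transpose_transpose)
    finally show ?thesis .
  qed
  have n3: "(U ** transpose B) \<bullet> (U ** transpose B) = c * ((\<Omega> ** transpose U) \<bullet> (\<Omega> ** transpose U)) + s * (U \<bullet> U)"
    unfolding inner_gram_right[OF B(2)]
    by (subst inner_transpose_transpose[symmetric, of "U ** transpose \<Omega>"]) (simp add: matrix_transpose_mul)
  have n4: "(A ** L) \<bullet> (A ** L) = (R\<^sub>h ** \<Theta> ** L) \<bullet> (R\<^sub>h ** \<Theta> ** L) + s * (L \<bullet> L)"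
    unfolding inner_gram_left[OF A'] by simp
  have sym: "(\<Theta> ** transpose T) \<bullet> (R ** (S ** transpose \<Omega>)) = (S ** transpose \<Omega>) \<bullet> (R ** (\<Theta> ** transpose T))"
    by (subst inner_commute) (simp add: inner_matrix_mult_left RT)
  have c4': "c * t1 + c * t2 = c * ((X ** transpose B) \<bullet> (A ** transpose Y)) + c * ((U ** transpose B) \<bullet> (A ** L))"
    unfolding distrib_left[symmetric] c4 ..
  show ?thesis
    unfolding E_def F_def C_def G_def
    using c1 c2 c3 c5 n1 n2 n3 n4 sym
    by (simp add: inner_add_left inner_add_right matrix_add_ldistrib matrix_scaleR_right
        inner_commute[of L U] inner_commute[of "R\<^sub>h ** \<Theta> ** L" "R\<^sub>h ** S ** transpose B"]
        inner_commute[of "\<Omega> ** transpose U" "T ** transpose A"]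
        inner_commute[of "A ** L" "U ** transpose B"] algebra_simps)
      (use c4' in linarith)
qed

section \<open>Positive definite overlaps and invertibility of their factors\<close>

lemma scaleR_mat_vec: "(k *\<^sub>R A) *v v = k *\<^sub>R (A *v v)"
  for A :: "real ^ 'k ^ 'n"
  by (simp add: scaleR_matrix_vector_assoc)

lemma inner_matrix_vector: "x \<bullet> (A *v y) = (transpose A *v x) \<bullet> y"
  for A :: "real ^ 'k ^ 'n"
  by (simp add: dot_lmul_matrix)

lemma pos_def_gram:
  fixes E :: "real ^ 'k ^ 'n"
  assumes R: "pos_semidef R" and "s > 0"
  shows "pos_def (transpose E ** R ** E + s *\<^sub>R mat 1)"
  unfolding pos_def_def
proof (intro conjI allI impI)
  have "transpose R = R" using R by (simp add: pos_semidef_def)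
  then show "transpose (transpose E ** R ** E + s *\<^sub>R mat 1) = transpose E ** R ** E + s *\<^sub>R mat 1"
    by (simp add: transpose_add transpose_scalar matrix_transpose_mul transpose_mat matrix_mul_assoc)
  fix v :: "real ^ 'k" assume "v \<noteq> 0"
  have "v \<bullet> ((transpose E ** R ** E) *v v) = (E *v v) \<bullet> (R *v (E *v v))"
    by (simp add: inner_matrix_vector[of v "transpose E"] flip: matrix_vector_mul_assoc del: transpose_matrix_vector)
  moreover have "\<dots> \<ge> 0" using R by (simp add: pos_semidef_def)
  moreover have "s * (v \<bullet> v) > 0" using \<open>v \<noteq> 0\<close> \<open>s > 0\<close> by simp
  ultimately show "0 < v \<bullet> ((transpose E ** R ** E + s *\<^sub>R mat 1) *v v)"
    by (simp add: matrix_vector_mult_add_rdistrib inner_add_right scaleR_mat_vec)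
qed

lemma invertible_if_pos_def_gram:
  fixes A :: "real ^ 'k ^ 'k"
  assumes "pos_def (transpose A ** A)"
  shows "invertible A"
proof -
  have "v = 0" if "A *v v = 0" for v
  proof (rule ccontr)
    assume "v \<noteq> 0"
    then have "0 < v \<bullet> ((transpose A ** A) *v v)"
      using assms by (simp add: pos_def_def)
    also have "\<dots> = 0"
      using that by (simp flip: matrix_vector_mul_assoc del: transpose_matrix_vector)
    finally show False by simp
  qed
  then show ?thesis
    by (metis invertible_left_inverse matrix_left_invertible_ker)
qed

lemma matrix_inv_mult:
  fixes A :: "real ^ 'k ^ 'k"
  assumes "invertible A"
  shows "A ** matrix_inv A = mat 1" "matrix_inv A ** A = mat 1"
  using someI_ex[of "\<lambda>A'. A ** A' = mat 1 \<and> A' ** A = mat 1"] assms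
  unfolding invertible_def matrix_inv_def by auto

section \<open>Continuity of the matrix operations\<close>

lemma continuous_on_if_const [continuous_intros]:
  "continuous_on S g \<Longrightarrow> continuous_on S h \<Longrightarrow> continuous_on S (\<lambda>x. if P then g x else h x)"
  by (cases P) simp_all

lemma continuous_on_matrix_mult [continuous_intros]:
  fixes f :: "'a::topological_space \<Rightarrow> real ^ 'k ^ 'n" and g :: "'a \<Rightarrow> real ^ 'p ^ 'k"
  shows "continuous_on S f \<Longrightarrow> continuous_on S g \<Longrightarrow> continuous_on S (\<lambda>x. f x ** g x)"
  unfolding matrix_matrix_mult_def by (intro continuous_intros)

lemma continuous_on_transpose [continuous_intros]:
  fixes f :: "'a::topological_space \<Rightarrow> real ^ 'k ^ 'n"
  shows "continuous_on S f \<Longrightarrow> continuous_on S (\<lambda>x. transpose (f x))"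
  unfolding transpose_def by (intro continuous_intros)

text \<open>By Cramer's rule every entry of the inverse is a quotient of determinants, which are
  polynomial in the entries.\<close>

lemma continuous_on_matrix_inv [continuous_intros]:
  fixes f :: "'a::topological_space \<Rightarrow> real ^ 'k ^ 'k"
  assumes f: "continuous_on S f" and inv: "\<And>x. x \<in> S \<Longrightarrow> invertible (f x)"
  shows "continuous_on S (\<lambda>x. matrix_inv (f x))"
proof -
  let ?g = "\<lambda>x. \<chi> i j. det (\<chi> a b. if b = i then (axis j 1 :: real ^ 'k) $ a else f x $ a $ b) / det (f x)"
  have "matrix_inv (f x) = ?g x" if "x \<in> S" for x
  proof -
    have "f x *v (matrix_inv (f x) *v axis j 1) = axis j 1" for j
      using inv[OF that] by (simp add: matrix_vector_mul_assoc matrix_inv_mult)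
    then have "matrix_inv (f x) *v axis j 1 =
        (\<chi> i. det (\<chi> a b. if b = i then (axis j 1 :: real ^ 'k) $ a else f x $ a $ b) / det (f x))" for j
      using inv[OF that] by (subst (asm) cramer) (simp_all add: invertible_det_nz)
    then show ?thesis
      by (simp add: vec_eq_iff matrix_vector_mult_basis column_def)
  qed
  moreover have "continuous_on S ?g"
  proof -
    have det: "continuous_on S (\<lambda>x. det (h x))" if "continuous_on S h" for h :: "'a \<Rightarrow> real ^ 'k ^ 'k"
      unfolding det_def using that by (intro continuous_intros)
    show ?thesis
      using f inv by (intro continuous_intros det) (auto simp: invertible_det_nz)
  qed
  ultimately show ?thesis
    by (simp cong: continuous_on_cong)
qed

lemma continuous_on_upper_part [continuous_intros]:
  "continuous_on S f \<Longrightarrow> continuous_on S (\<lambda>x. upper_part (f x))"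
  unfolding upper_part_def by (intro continuous_intros)

lemma continuous_on_strict_upper_part [continuous_intros]:
  "continuous_on S f \<Longrightarrow> continuous_on S (\<lambda>x. strict_upper_part (f x))"
  unfolding strict_upper_part_def by (intro continuous_intros)

lemma continuous_on_rows_with [continuous_intros]:
  "continuous_on S f \<Longrightarrow> continuous_on S (\<lambda>x. rows_with lab \<zeta> (f x))"
  for f :: "'a::topological_space \<Rightarrow> real ^ 'k ^ 'm"
  unfolding rows_with_def by (intro continuous_intros)

lemma continuous_on_assemble_rows [continuous_intros]:
  "(\<And>\<zeta>. continuous_on S (\<lambda>x. f x \<zeta>)) \<Longrightarrow> continuous_on S (\<lambda>x. assemble_rows lab (f x))"
  for f :: "'a::topological_space \<Rightarrow> 'z \<Rightarrow> real ^ 'k ^ 'm"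
  unfolding assemble_rows_def by (intro continuous_intros)

section \<open>Inverses of block upper-triangular matrices\<close>

text \<open>\<open>A\<close> maps the vectors supported on the blocks up to \<open>l\<close> into
  themselves; being injective, it maps this subspace onto itself by dimension.\<close>

lemma block_upper_triangular_inverse_aux:
  assumes A: "block_upper_triangular A" and inv: "invertible A"
    and v: "\<And>a. l < fst a \<Longrightarrow> v $ a = 0"
  obtains w where "A *v w = v" "\<And>a. l < fst a \<Longrightarrow> w $ a = 0"
proof -
  define W where "W = {v :: real ^ ('a \<times> 'b). \<forall>a. l < fst a \<longrightarrow> v $ a = 0}"
  have W: "subspace W"
    by (auto simp: W_def subspace_def)
  have "(A *v w) $ a = 0" if "w \<in> W" "l < fst a" for w a
  proof -
    have "A $ a $ b * w $ b = 0" for b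
    proof (cases "fst b < fst a")
      case False
      with that have "l < fst b" by simp
      then show ?thesis using that(1) unfolding W_def by (cases b) force
    qed (simp add: block_upper_triangularD A)
    then show ?thesis by (auto simp: matrix_vector_mult_def intro!: sum.neutral)
  qed
  then have sub: "(*v) A ` W \<subseteq> W"
    by (auto simp: W_def)
  have inj: "inj ((*v) A)"
    using inv by (simp add: inj_matrix_vector_mult)
  have "dim ((*v) A ` W) = dim W"
    by (rule dim_image_eq) (use inj in \<open>auto intro: inj_on_subset\<close>)
  then have "(*v) A ` W = W"
    using sub W by (intro subspace_dim_equal) (auto intro: linear_subspace_image)
  moreover have "v \<in> W" using v by (simp add: W_def)
  ultimately obtain w where "w \<in> W" "A *v w = v" by (metis imageE)
  with that show ?thesis by (auto simp: W_def)
qed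

text \<open>Column \<open>b\<close> of the inverse is the preimage of a basis vector supported on
  the blocks up to \<open>fst b\<close>, so it is supported there too.\<close>

lemma block_upper_triangular_matrix_inv:
  assumes "block_upper_triangular A" "invertible A"
  shows "block_upper_triangular (matrix_inv A)"
  unfolding block_upper_triangular_def
proof (intro allI impI)
  fix a b :: "'a \<times> 'b" assume ba: "fst b < fst a"
  obtain w where w: "A *v w = axis b 1" "\<And>a. fst b < fst a \<Longrightarrow> w $ a = 0"
    by (rule block_upper_triangular_inverse_aux[OF assms, of "fst b" "axis b 1"])
      (auto simp: axis_def)
  have "matrix_inv A *v axis b 1 = w"
    using assms by (simp flip: w(1) add: matrix_vector_mul_assoc matrix_inv_mult)
  then show "matrix_inv A $ a $ b = 0"
    using w(2)[OF ba] by (auto simp: matrix_vector_mult_basis column_def)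
qed

lemma same_leading_blocks_D:
  "same_leading_blocks l V V' \<Longrightarrow> fst a \<le> l \<Longrightarrow> fst b \<le> l \<Longrightarrow> V $ a $ b = V' $ a $ b"
  unfolding same_leading_blocks_def by blast

text \<open>The preimage of a leading basis vector under \<open>A\<close> has only leading
  coordinates, on which \<open>A\<close> and \<open>B\<close> act alike; it is therefore the
  corresponding column of both inverses.\<close>

lemma same_leading_blocks_matrix_inv:
  assumes A: "block_upper_triangular A" "invertible A" and B: "block_upper_triangular B" "invertible B"
    and same: "same_leading_blocks l A B"
  shows "same_leading_blocks l (matrix_inv A) (matrix_inv B)"
  unfolding same_leading_blocks_def
proof (intro allI impI)
  fix a b :: "'a \<times> 'b" assume b: "fst b \<le> l"
  obtain w where w: "A *v w = axis b 1" "\<And>a. l < fst a \<Longrightarrow> w $ a = 0"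
    by (rule block_upper_triangular_inverse_aux[OF A, of l "axis b 1"])
      (use b in \<open>auto simp: axis_def\<close>)
  have "A $ c $ d * w $ d = B $ c $ d * w $ d" for c d
  proof (cases "fst d \<le> l")
    case True
    show ?thesis
    proof (cases "fst c \<le> l")
      case False
      with True have "fst d < fst c" by simp
      then show ?thesis using A B by (simp add: block_upper_triangularD)
    qed (use same True in \<open>simp add: same_leading_blocks_D\<close>)
  qed (simp add: w)
  then have "B *v w = axis b 1"
    unfolding w(1)[symmetric] by (simp only: matrix_vector_mult_def)
  then have "matrix_inv B *v axis b 1 = w"
    using B by (simp add: matrix_vector_mul_assoc matrix_inv_mult flip: \<open>B *v w = axis b 1\<close>)
  moreover have "matrix_inv A *v axis b 1 = w"
    using A by (simp add: matrix_vector_mul_assoc matrix_inv_mult flip: w(1))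
  ultimately have "(matrix_inv A *v axis b 1) $ a = (matrix_inv B *v axis b 1) $ a" by simp
  then show "matrix_inv A $ a $ b = matrix_inv B $ a $ b"
    by (simp add: matrix_vector_mult_basis column_def)
qed

section \<open>Causality and continuity of the maps\<close>

text \<open>Reduces agreement before a time to agreement up to each earlier time, so the rules for
  \<open>same_cols_le\<close> serve for both.\<close>

lemma same_cols_lt_iff: "same_cols_lt l E E' \<longleftrightarrow> (\<forall>k<l. same_cols_le k E E')"
  unfolding same_cols_lt_def same_cols_le_def by force

lemma same_cols_le_refl [simp]: "same_cols_le l E E"
  by (simp add: same_cols_le_def)

lemma same_cols_le_D: "same_cols_le l E E' \<Longrightarrow> fst b \<le> l \<Longrightarrow> E $ a $ b = E' $ a $ b"
  by (cases b) (auto simp: same_cols_le_def)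

lemma same_cols_leI: "(\<And>a b. fst b \<le> l \<Longrightarrow> E $ a $ b = E' $ a $ b) \<Longrightarrow> same_cols_le l E E'"
  by (simp add: same_cols_le_def)

lemma same_cols_le_add:
  "same_cols_le l E E' \<Longrightarrow> same_cols_le l F F' \<Longrightarrow> same_cols_le l (E + F) (E' + F')"
  by (simp add: same_cols_le_def)

lemma same_cols_le_scaleR: "same_cols_le l E E' \<Longrightarrow> same_cols_le l (c *\<^sub>R E) (c *\<^sub>R E')"
  by (simp add: same_cols_le_def)

lemma same_cols_le_sum:
  "(\<And>x. x \<in> S \<Longrightarrow> same_cols_le l (f x) (g x)) \<Longrightarrow> same_cols_le l (sum f S) (sum g S)"
  by (simp add: same_cols_le_def)

lemma same_cols_le_assemble_rows:
  "(\<And>\<zeta>. same_cols_le l (f \<zeta>) (g \<zeta>)) \<Longrightarrow> same_cols_le l (assemble_rows lab f) (assemble_rows lab g)"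
  by (simp add: same_cols_le_def assemble_rows_def)

lemma same_cols_le_rows_with:
  "same_cols_le l E E' \<Longrightarrow> same_cols_le l (rows_with lab \<zeta> E) (rows_with lab \<zeta> E')"
  by (simp add: same_cols_le_def rows_with_def)

lemma same_cols_le_mult_left: "same_cols_le l E E' \<Longrightarrow> same_cols_le l (F ** E) (F ** E')"
  by (simp add: same_cols_le_def matrix_matrix_mult_def)

text \<open>Column \<open>b\<close> of a product with a block upper-triangular right factor reads
  only columns of the left factor at times up to that of \<open>b\<close>.\<close>

lemma same_cols_le_mult:
  fixes E E' :: "real ^ ('l::{finite,linorder} \<times> 'j::finite) ^ 'n"
  assumes "same_cols_le l E E'" "same_leading_blocks l A A'"
    and "block_upper_triangular A" "block_upper_triangular A'"
  shows "same_cols_le l (E ** A) (E' ** A')"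
proof (rule same_cols_leI)
  fix a and b :: "'l \<times> 'j" assume b: "fst b \<le> l"
  have "E $ a $ c * A $ c $ b = E' $ a $ c * A' $ c $ b" for c
  proof (cases "fst c \<le> fst b")
    case True
    with b have "fst c \<le> l" by simp
    then show ?thesis
      using assms b by (simp add: same_cols_le_D same_leading_blocks_D)
  next
    case False
    then show ?thesis using assms by (simp add: block_upper_triangularD)
  qed
  then show "(E ** A) $ a $ b = (E' ** A') $ a $ b"
    by (simp add: matrix_matrix_mult_def)
qed

lemma same_leading_blocks_upper_part:
  "same_cols_le l F F' \<Longrightarrow> same_leading_blocks l (upper_part F) (upper_part F')"
  by (simp add: same_leading_blocks_def upper_part_def same_cols_le_D)

text \<open>With the diagonal blocks removed, the columns at time \<open>l\<close> read
  \<open>E\<close> only at earlier times. This lets the equation for p(l) contain Omega although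
  omega(l) depends on p(l).\<close>

lemma same_cols_le_mult_strict_upper_part:
  fixes E E' :: "real ^ ('l::{finite,linorder} \<times> 'j::finite) ^ 'n"
  assumes "same_cols_lt l E E'" "same_cols_le l F F'"
  shows "same_cols_le l (E ** strict_upper_part F) (E' ** strict_upper_part F')"
proof (rule same_cols_leI)
  fix a and b :: "'l \<times> 'j" assume b: "fst b \<le> l"
  have "E $ a $ c * strict_upper_part F $ c $ b = E' $ a $ c * strict_upper_part F' $ c $ b" for c
  proof (cases "fst c < fst b")
    case True
    with b have "fst c < l" by simp
    then show ?thesis
      using assms b by (cases c) (auto simp: same_cols_le_D same_cols_lt_def strict_upper_part_def)
  qed (simp add: strict_upper_part_def)
  then show "(E ** strict_upper_part F) $ a $ b = (E' ** strict_upper_part F') $ a $ b"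
    by (simp add: matrix_matrix_mult_def)
qed

lemma same_leading_blocks_gram:
  "same_cols_le l E E' \<Longrightarrow> same_leading_blocks l (transpose E ** R ** E) (transpose E' ** R ** E')"
  by (simp add: same_leading_blocks_def transpose_def matrix_matrix_mult_def same_cols_le_D)

context
  fixes D :: "('n::finite, 'm::finite, 'l::{finite,linorder}, 'j::finite, 'z::finite, 'y) query_data"
    and \<sigma> :: real
  assumes D: "query_assms D" and \<sigma>: "\<sigma> > 0"
begin

lemma pos_def_V_theta: "pos_def (V_theta D \<sigma> \<zeta> \<xi>)"
  unfolding V_theta_def using D \<sigma> by (intro pos_def_gram) (auto simp: query_assms_def)

text \<open>Gives \<open>V_omega\<close> the same form as \<open>V_theta\<close>, with a multiple of
  the identity as covariance, so that one lemma on Gram matrices covers both.\<close>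

lemma V_omega_eq: "V_omega D \<sigma> \<zeta> \<xi> =
    transpose (Omega_sub D \<zeta> \<xi>) ** ((1 / real CARD('m)) *\<^sub>R mat 1) ** Omega_sub D \<zeta> \<xi> + \<sigma>\<^sup>2 *\<^sub>R mat 1"
  by (simp add: V_omega_def matrix_scaleR_left matrix_scaleR_right)

lemma pos_def_V_omega: "pos_def (V_omega D \<sigma> \<zeta> \<xi>)"
  unfolding V_omega_eq using \<sigma>
  by (intro pos_def_gram) (auto simp: pos_semidef_def transpose_scalar transpose_mat scaleR_mat_vec)

lemma A_theta_props:
  "block_upper_triangular (A_theta D \<sigma> \<zeta> \<xi>)"
  "transpose (A_theta D \<sigma> \<zeta> \<xi>) ** A_theta D \<sigma> \<zeta> \<xi> = V_theta D \<sigma> \<zeta> \<xi>"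
  "invertible (A_theta D \<sigma> \<zeta> \<xi>)"
proof -
  have "block_cholesky (chol_theta D \<zeta>)" using D by (simp add: query_assms_def)
  then show 1: "block_upper_triangular (A_theta D \<sigma> \<zeta> \<xi>)"
      "transpose (A_theta D \<sigma> \<zeta> \<xi>) ** A_theta D \<sigma> \<zeta> \<xi> = V_theta D \<sigma> \<zeta> \<xi>"
    using pos_def_V_theta[of \<zeta> \<xi>] unfolding block_cholesky_def A_theta_def by metis+
  show "invertible (A_theta D \<sigma> \<zeta> \<xi>)"
    by (rule invertible_if_pos_def_gram) (simp add: 1 pos_def_V_theta)
qed

lemma A_omega_props:
  "block_upper_triangular (A_omega D \<sigma> \<zeta> \<xi>)"
  "transpose (A_omega D \<sigma> \<zeta> \<xi>) ** A_omega D \<sigma> \<zeta> \<xi> = V_omega D \<sigma> \<zeta> \<xi>"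
  "invertible (A_omega D \<sigma> \<zeta> \<xi>)"
proof -
  have "block_cholesky (chol_omega D \<zeta>)" using D by (simp add: query_assms_def)
  then show 1: "block_upper_triangular (A_omega D \<sigma> \<zeta> \<xi>)"
      "transpose (A_omega D \<sigma> \<zeta> \<xi>) ** A_omega D \<sigma> \<zeta> \<xi> = V_omega D \<sigma> \<zeta> \<xi>"
    using pos_def_V_omega[of \<zeta> \<xi>] unfolding block_cholesky_def A_omega_def by metis+
  show "invertible (A_omega D \<sigma> \<zeta> \<xi>)"
    by (rule invertible_if_pos_def_gram) (simp add: 1 pos_def_V_omega)
qed

lemma continuous_Theta [continuous_intros]: "continuous_on UNIV (Theta D)"
proof -
  have "continuous_on UNIV (\<lambda>\<xi>. query_theta D l \<xi> yv)" for l yv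
    using D by (auto simp: query_assms_def intro: differentiable_imp_continuous_on)
  then show ?thesis unfolding Theta_def[abs_def] by (intro continuous_intros)
qed

lemma continuous_Omega [continuous_intros]: "continuous_on UNIV (Omega D)"
proof -
  have "continuous_on UNIV (\<lambda>\<xi>. query_omega D l \<xi> yv)" for l yv
    using D by (auto simp: query_assms_def intro: differentiable_imp_continuous_on)
  then show ?thesis unfolding Omega_def[abs_def] by (intro continuous_intros)
qed

lemma continuous_Omega_sub [continuous_intros]: "continuous_on UNIV (Omega_sub D \<zeta>)"
  unfolding Omega_sub_def[abs_def] by (intro continuous_intros)

lemma continuous_A_theta [continuous_intros]: "continuous_on UNIV (A_theta D \<sigma> \<zeta>)"
proof -
  have "continuous_on {V. pos_def V} (chol_theta D \<zeta>)"
    using D by (auto simp: query_assms_def block_cholesky_def intro: differentiable_imp_continuous_on)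
  moreover have "continuous_on UNIV (V_theta D \<sigma> \<zeta>)"
    unfolding V_theta_def[abs_def] by (intro continuous_intros)
  ultimately show ?thesis
    unfolding A_theta_def[abs_def] by (rule continuous_on_compose2) (auto simp: pos_def_V_theta)
qed

lemma continuous_A_omega [continuous_intros]: "continuous_on UNIV (A_omega D \<sigma> \<zeta>)"
proof -
  have "continuous_on {V. pos_def V} (chol_omega D \<zeta>)"
    using D by (auto simp: query_assms_def block_cholesky_def intro: differentiable_imp_continuous_on)
  moreover have "continuous_on UNIV (V_omega D \<sigma> \<zeta>)"
    unfolding V_omega_def[abs_def] by (intro continuous_intros)
  ultimately show ?thesis
    unfolding A_omega_def[abs_def] by (rule continuous_on_compose2) (auto simp: pos_def_V_omega)
qed

lemma continuous_psi: "continuous_on UNIV (psi D \<sigma> z N)"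
  unfolding psi_def[abs_def] by (intro continuous_intros A_theta_props A_omega_props)

lemma continuous_phi': "continuous_on UNIV (phi' D \<sigma> z N)"
  unfolding phi'_def[abs_def] phi_def by (intro continuous_intros A_theta_props A_omega_props)

lemma continuous_rho0: "continuous_on UNIV (rho0 D)"
  unfolding rho0_def[abs_def] by (intro continuous_intros)

lemma same_cols_Theta:
  assumes "same_cols_lt l (fst \<xi>) (fst \<xi>')" "same_cols_lt l (snd \<xi>) (snd \<xi>')"
  shows "same_cols_le l (Theta D \<xi>) (Theta D \<xi>')"
proof (rule same_cols_leI)
  fix a and b :: "'l \<times> 'j" assume "fst b \<le> l"
  then have "same_cols_lt (fst b) (fst \<xi>) (fst \<xi>')" "same_cols_lt (fst b) (snd \<xi>) (snd \<xi>')"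
    using assms by (auto simp: same_cols_lt_def)
  moreover have "causal_theta (query_theta D)"
    using D by (simp add: query_assms_def)
  ultimately have "query_theta D (fst b) (fst \<xi>, snd \<xi>) (obs_vec D) = query_theta D (fst b) (fst \<xi>', snd \<xi>') (obs_vec D)"
    unfolding causal_theta_def by blast
  then show "Theta D \<xi> $ a $ b = Theta D \<xi>' $ a $ b" by (simp add: Theta_def)
qed

lemma same_cols_Omega:
  assumes "same_cols_lt l (fst \<xi>) (fst \<xi>')" "same_cols_le l (snd \<xi>) (snd \<xi>')"
  shows "same_cols_le l (Omega D \<xi>) (Omega D \<xi>')"
proof (rule same_cols_leI)
  fix a and b :: "'l \<times> 'j" assume "fst b \<le> l"
  then have "same_cols_lt (fst b) (fst \<xi>) (fst \<xi>')" "same_cols_le (fst b) (snd \<xi>) (snd \<xi>')"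
    using assms by (auto simp: same_cols_lt_def same_cols_le_def)
  moreover have "causal_omega (query_omega D)"
    using D by (simp add: query_assms_def)
  ultimately have "query_omega D (fst b) (fst \<xi>, snd \<xi>) (obs_vec D) = query_omega D (fst b) (fst \<xi>', snd \<xi>') (obs_vec D)"
    unfolding causal_omega_def by blast
  then show "Omega D \<xi> $ a $ b = Omega D \<xi>' $ a $ b" by (simp add: Omega_def)
qed

lemma same_leading_blocks_A_theta:
  assumes "same_cols_le l (Theta D \<xi>) (Theta D \<xi>')"
  shows "same_leading_blocks l (A_theta D \<sigma> \<zeta> \<xi>) (A_theta D \<sigma> \<zeta> \<xi>')"
proof -
  have "block_cholesky (chol_theta D \<zeta>)" using D by (simp add: query_assms_def)
  moreover have "same_leading_blocks l (V_theta D \<sigma> \<zeta> \<xi>) (V_theta D \<sigma> \<zeta> \<xi>')"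
    using same_leading_blocks_gram[OF assms, of "covar D \<zeta>"]
    by (simp add: V_theta_def same_leading_blocks_def)
  ultimately show ?thesis
    unfolding block_cholesky_def A_theta_def using pos_def_V_theta by blast
qed

lemma same_leading_blocks_A_omega:
  assumes "same_cols_le l (Omega D \<xi>) (Omega D \<xi>')"
  shows "same_leading_blocks l (A_omega D \<sigma> \<zeta> \<xi>) (A_omega D \<sigma> \<zeta> \<xi>')"
proof -
  have "block_cholesky (chol_omega D \<zeta>)" using D by (simp add: query_assms_def)
  moreover have "same_leading_blocks l (V_omega D \<sigma> \<zeta> \<xi>) (V_omega D \<sigma> \<zeta> \<xi>')"
    using same_leading_blocks_gram[OF same_cols_le_rows_with[OF assms, of "label D" \<zeta>], of "(1 / real CARD('m)) *\<^sub>R mat 1"]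
    by (simp add: V_omega_eq same_leading_blocks_def Omega_sub_def)
  ultimately show ?thesis
    unfolding block_cholesky_def A_omega_def using pos_def_V_omega by blast
qed

lemmas A_theta_leading = same_leading_blocks_A_theta A_theta_props
  same_leading_blocks_matrix_inv block_upper_triangular_matrix_inv
lemmas A_omega_leading = same_leading_blocks_A_omega A_omega_props
  same_leading_blocks_matrix_inv block_upper_triangular_matrix_inv

lemma same_cols_Omega_sub_inv:
  assumes "same_cols_lt l (Omega D \<xi>) (Omega D \<xi>')"
  shows "same_cols_lt l (Omega_sub D \<zeta> \<xi> ** matrix_inv (A_omega D \<sigma> \<zeta> \<xi>))
      (Omega_sub D \<zeta> \<xi>' ** matrix_inv (A_omega D \<sigma> \<zeta> \<xi>'))"
  using assms unfolding same_cols_lt_iff Omega_sub_def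
  by (auto intro!: same_cols_le_mult same_cols_le_rows_with A_omega_leading)

lemma same_cols_lt_Omega:
  assumes "same_cols_lt l (fst \<xi>) (fst \<xi>')" "same_cols_lt l (snd \<xi>) (snd \<xi>')"
  shows "same_cols_lt l (Omega D \<xi>) (Omega D \<xi>')"
  unfolding same_cols_lt_iff
proof (intro allI impI same_cols_Omega)
  show "same_cols_lt k (fst \<xi>) (fst \<xi>')" if "k < l" for k
    using assms that by (auto simp: same_cols_lt_def)
  show "same_cols_le k (snd \<xi>) (snd \<xi>')" if "k < l" for k
    using assms that by (auto simp: same_cols_lt_iff)
qed

lemma same_cols_lt_if_le: "same_cols_le l E E' \<Longrightarrow> same_cols_lt l E E'"
  by (simp add: same_cols_lt_def same_cols_le_def)

lemma same_cols_mult_A_theta: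
  assumes "same_cols_le l (Theta D \<xi>) (Theta D \<xi>')"
  shows "same_cols_le l (E ** A_theta D \<sigma> \<zeta> \<xi>) (E ** A_theta D \<sigma> \<zeta> \<xi>')"
  by (intro same_cols_le_mult same_cols_le_refl A_theta_leading assms)

lemma same_cols_mult_A_omega:
  assumes "same_cols_le l (Omega D \<xi>) (Omega D \<xi>')"
  shows "same_cols_le l (E ** A_omega D \<sigma> \<zeta> \<xi>) (E ** A_omega D \<sigma> \<zeta> \<xi>')"
  by (intro same_cols_le_mult same_cols_le_refl A_omega_leading assms)

lemma same_cols_Theta_upper_part:
  assumes "same_cols_le l (Theta D \<xi>) (Theta D \<xi>')" "same_cols_le l F F'"
  shows "same_cols_le l (E ** Theta D \<xi> ** matrix_inv (A_theta D \<sigma> \<zeta> \<xi>) ** upper_part F)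
    (E ** Theta D \<xi>' ** matrix_inv (A_theta D \<sigma> \<zeta> \<xi>') ** upper_part F')"
proof (rule same_cols_le_mult)
  show "same_cols_le l (E ** Theta D \<xi> ** matrix_inv (A_theta D \<sigma> \<zeta> \<xi>)) (E ** Theta D \<xi>' ** matrix_inv (A_theta D \<sigma> \<zeta> \<xi>'))"
    by (intro same_cols_le_mult A_theta_leading assms) (rule same_cols_le_mult_left, rule assms)
qed (simp_all add: assms same_leading_blocks_upper_part block_upper_triangular_upper_part)

lemma same_cols_mult_Omega_sub:
  assumes "same_cols_le l (Omega D \<xi>) (Omega D \<xi>')"
  shows "same_cols_le l (E ** Omega_sub D \<zeta> \<xi>) (E ** Omega_sub D \<zeta> \<xi>')"
  unfolding Omega_sub_def by (intro same_cols_le_mult_left same_cols_le_rows_with assms)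

text \<open>theta(l) depends on the strict past and may be read freely, whereas Omega occurs only in
  front of a strict upper part.\<close>

lemma psi_causal_snd:
  assumes "same_cols_lt l (fst \<xi>) (fst \<xi>')" "same_cols_lt l (snd \<xi>) (snd \<xi>')"
  shows "same_cols_le l (snd (psi D \<sigma> z N \<xi>)) (snd (psi D \<sigma> z N \<xi>'))"
  unfolding psi_def snd_conv
  by (intro same_cols_le_assemble_rows same_cols_le_add same_cols_mult_A_theta
      same_cols_le_mult_strict_upper_part same_cols_Omega_sub_inv same_cols_lt_Omega
      same_cols_le_mult_left[OF same_cols_Theta] same_cols_Theta
      same_cols_le_scaleR same_cols_le_refl assms)

text \<open>Here p(l) is already known, hence omega(l) too, and the upper part may keep its diagonal
  blocks.\<close>

lemma psi_causal_fst:
  assumes "same_cols_lt l (fst \<xi>) (fst \<xi>')" "same_cols_le l (snd \<xi>) (snd \<xi>')"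
  shows "same_cols_le l (fst (psi D \<sigma> z N \<xi>)) (fst (psi D \<sigma> z N \<xi>'))"
  unfolding psi_def fst_conv
  by (intro same_cols_le_sum same_cols_le_add same_cols_mult_A_omega same_cols_Theta_upper_part
      same_cols_mult_Omega_sub same_cols_Theta same_cols_Omega
      same_cols_le_scaleR same_cols_le_refl assms same_cols_lt_if_le)

lemma phi'_causal_snd:
  assumes "same_cols_lt l (fst \<xi>) (fst \<xi>')" "same_cols_lt l (snd \<xi>) (snd \<xi>')"
  shows "same_cols_le l (snd (phi' D \<sigma> z N \<xi>)) (snd (phi' D \<sigma> z N \<xi>'))"
  unfolding phi'_def phi_def snd_conv snd_add snd_scaleR
  by (intro same_cols_le_assemble_rows same_cols_le_add same_cols_mult_A_theta
      same_cols_le_mult_strict_upper_part same_cols_Omega_sub_inv same_cols_lt_Omega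
      same_cols_le_mult_left[OF same_cols_Theta] same_cols_Theta
      same_cols_le_scaleR same_cols_le_refl assms)

lemma phi'_causal_fst:
  assumes "same_cols_lt l (fst \<xi>) (fst \<xi>')" "same_cols_le l (snd \<xi>) (snd \<xi>')"
  shows "same_cols_le l (fst (phi' D \<sigma> z N \<xi>)) (fst (phi' D \<sigma> z N \<xi>'))"
  unfolding phi'_def phi_def fst_conv fst_add fst_scaleR
  by (intro same_cols_le_add same_cols_le_scaleR same_cols_le_mult_left[OF same_cols_Omega]
      same_cols_le_sum same_cols_Theta_upper_part same_cols_mult_A_omega
      same_cols_Theta same_cols_Omega same_cols_le_refl assms same_cols_lt_if_le)

text \<open>Adding \<xi> cancels the terms -Q and -P of \<open>rho0\<close>, which would make a
  column depend on itself.\<close>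

lemma rho0_causal:
  "same_cols_lt l (fst \<xi>) (fst \<xi>') \<Longrightarrow> same_cols_lt l (snd \<xi>) (snd \<xi>') \<Longrightarrow>
    same_cols_le l (snd (rho0 D \<xi> + \<xi>)) (snd (rho0 D \<xi>' + \<xi>'))"
  "same_cols_lt l (fst \<xi>) (fst \<xi>') \<Longrightarrow> same_cols_le l (snd \<xi>) (snd \<xi>') \<Longrightarrow>
    same_cols_le l (fst (rho0 D \<xi> + \<xi>)) (fst (rho0 D \<xi>' + \<xi>'))"
  using same_cols_Theta[of l \<xi> \<xi>'] same_cols_Omega[of l \<xi> \<xi>']
  by (simp_all add: rho0_def same_cols_le_mult_left same_cols_le_scaleR)

end

section \<open>Linear forms in the noise\<close>

lemma UNIV_noise_index:
  "UNIV = range (\<lambda>(\<zeta>, a, k). Ind_U \<zeta> a k) \<union> range (\<lambda>(i, k). Ind_V i k) \<union> range (\<lambda>(\<zeta>, a, k). Ind_G \<zeta> a k) \<union>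
     range (\<lambda>(i, k). Ind_H i k) \<union> range (\<lambda>(\<zeta>, a, k). Ind_W \<zeta> a k) \<union> range (\<lambda>(\<zeta>, a, k). Ind_Gamma \<zeta> a k)"
    (is "_ = ?A")
proof -
  have "\<iota> \<in> ?A" for \<iota>
    by (cases \<iota>) (auto simp: image_iff)
  then show ?thesis by blast
qed

instance noise_index :: (finite, finite, finite, finite) finite
  by standard (simp add: UNIV_noise_index)

lemma sum_noise_index:
  fixes f :: "('n::finite, 'm::finite, 'k::finite, 'z::finite) noise_index \<Rightarrow> real"
  shows "sum f UNIV = (\<Sum>\<zeta>\<in>UNIV. \<Sum>a\<in>UNIV. \<Sum>k\<in>UNIV. f (Ind_U \<zeta> a k)) + (\<Sum>i\<in>UNIV. \<Sum>k\<in>UNIV. f (Ind_V i k))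
    + (\<Sum>\<zeta>\<in>UNIV. \<Sum>a\<in>UNIV. \<Sum>k\<in>UNIV. f (Ind_G \<zeta> a k)) + (\<Sum>i\<in>UNIV. \<Sum>k\<in>UNIV. f (Ind_H i k))
    + (\<Sum>\<zeta>\<in>UNIV. \<Sum>a\<in>UNIV. \<Sum>k\<in>UNIV. f (Ind_W \<zeta> a k)) + (\<Sum>\<zeta>\<in>UNIV. \<Sum>a\<in>UNIV. \<Sum>k\<in>UNIV. f (Ind_Gamma \<zeta> a k))"
proof -
  have range2: "sum f (range (\<lambda>(a, b). c a b)) = (\<Sum>a\<in>UNIV. \<Sum>b\<in>UNIV. f (c a b))"
    if "inj (\<lambda>(a, b). c a b)" for c :: "'b::finite \<Rightarrow> 'c::finite \<Rightarrow> _"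
    unfolding sum.reindex[OF that] by (simp add: sum.cartesian_product case_prod_unfold)
  have range3: "sum f (range (\<lambda>(a, b, d). c a b d)) = (\<Sum>a\<in>UNIV. \<Sum>b\<in>UNIV. \<Sum>d\<in>UNIV. f (c a b d))"
    if "inj (\<lambda>(a, b, d). c a b d)" for c :: "'b::finite \<Rightarrow> 'c::finite \<Rightarrow> 'd::finite \<Rightarrow> _"
    unfolding sum.reindex[OF that] by (simp add: sum.cartesian_product case_prod_unfold)
  show ?thesis
    unfolding UNIV_noise_index
    apply (subst sum.union_disjoint, simp, simp, force)+
    apply (simp add: range3 inj_def)
    apply (simp add: range2 inj_def)
    done
qed

text \<open>The coefficients of a linear form in the centred noise are again recorded as a \<open>noise\<close>.\<close>

definition noise_form ::
  "('n::finite, 'm::finite, 'l::finite, 'j::finite, 'z::finite, 'y) query_data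
     \<Rightarrow> ('n, 'm, 'l, 'j, 'z) noise \<Rightarrow> ('n, 'm, 'l, 'j, 'z) noise \<Rightarrow> real" where
  "noise_form D C N =
     (\<Sum>i\<in>UNIV. sample C i \<bullet> (sample N i - mean D (label D i))) +
     (\<Sum>\<iota>\<in>UNIV. noise_entry \<iota> C * noise_entry \<iota> N)"

definition noise_form_variance ::
  "('n::finite, 'm::finite, 'l::finite, 'j::finite, 'z::finite, 'y) query_data
     \<Rightarrow> ('n, 'm, 'l, 'j, 'z) noise \<Rightarrow> real" where
  "noise_form_variance D C =
     (\<Sum>i\<in>UNIV. sample C i \<bullet> (covar D (label D i) *v sample C i)) +
     (\<Sum>\<iota>\<in>UNIV. (noise_entry \<iota> C)\<^sup>2)"

lemma noise_form_eq:
  "noise_form D C N =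
     (\<Sum>i\<in>UNIV. sample C i \<bullet> (sample N i - mean D (label D i))) +
     (\<Sum>\<zeta>\<in>UNIV. noise_U C \<zeta> \<bullet> noise_U N \<zeta>) + noise_V C \<bullet> noise_V N +
     (\<Sum>\<zeta>\<in>UNIV. noise_G C \<zeta> \<bullet> noise_G N \<zeta>) + noise_H C \<bullet> noise_H N +
     (\<Sum>\<zeta>\<in>UNIV. noise_W C \<zeta> \<bullet> noise_W N \<zeta>) + (\<Sum>\<zeta>\<in>UNIV. noise_Gamma C \<zeta> \<bullet> noise_Gamma N \<zeta>)"
  by (simp add: noise_form_def sum_noise_index inner_vec_def)

lemma noise_form_variance_eq:
  "noise_form_variance D C =
     (\<Sum>i\<in>UNIV. sample C i \<bullet> (covar D (label D i) *v sample C i)) +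
     (\<Sum>\<zeta>\<in>UNIV. noise_U C \<zeta> \<bullet> noise_U C \<zeta>) + noise_V C \<bullet> noise_V C +
     (\<Sum>\<zeta>\<in>UNIV. noise_G C \<zeta> \<bullet> noise_G C \<zeta>) + noise_H C \<bullet> noise_H C +
     (\<Sum>\<zeta>\<in>UNIV. noise_W C \<zeta> \<bullet> noise_W C \<zeta>) + (\<Sum>\<zeta>\<in>UNIV. noise_Gamma C \<zeta> \<bullet> noise_Gamma C \<zeta>)"
proof -
  have "(\<Sum>\<iota>\<in>UNIV. (noise_entry \<iota> C)\<^sup>2) =
     (\<Sum>\<zeta>\<in>UNIV. noise_U C \<zeta> \<bullet> noise_U C \<zeta>) + noise_V C \<bullet> noise_V C +
     (\<Sum>\<zeta>\<in>UNIV. noise_G C \<zeta> \<bullet> noise_G C \<zeta>) + noise_H C \<bullet> noise_H C +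
     (\<Sum>\<zeta>\<in>UNIV. noise_W C \<zeta> \<bullet> noise_W C \<zeta>) + (\<Sum>\<zeta>\<in>UNIV. noise_Gamma C \<zeta> \<bullet> noise_Gamma C \<zeta>)"
    by (simp only: sum_noise_index) (simp add: inner_vec_def power2_eq_square)
  then show ?thesis by (simp add: noise_form_variance_def)
qed

text \<open>The scale \<open>b\<close> absorbs the frequency, so evaluation at 1 is all that is
  needed for linear forms with arbitrary coefficients.\<close>

lemma (in prob_space) char_scaled_std_normal:
  assumes X: "distributed M lborel X std_normal_density"
  shows "char (distr M borel (\<lambda>w. b * X w)) 1 = exp (- b\<^sup>2 / 2)"
proof -
  have [measurable]: "X \<in> borel_measurable M"
    using distributed_measurable[OF X] by simp
  have "char (distr M borel (\<lambda>w. b * X w)) 1 = char (distr M borel X) b"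
    by (simp add: char_def integral_distr)
  also have "distr M borel X = distr M lborel X"
    by (rule distr_cong) auto
  also have "\<dots> = std_normal_distribution"
    by (rule distributed_distr_eq_density[OF X])
  finally show ?thesis by (simp add: char_std_normal_distribution)
qed

text \<open>In a direction of zero variance there is no density: the form is almost surely constant,
  and both sides equal 1.\<close>

lemma (in prob_space) char_gaussian_vector_form:
  assumes X: "gaussian_vector M X \<mu> S" and S: "0 \<le> a \<bullet> (S *v a)"
  shows "char (distr M borel (\<lambda>w. a \<bullet> (X w - \<mu>))) 1 = exp (- (a \<bullet> (S *v a)) / 2)"
proof (cases "a \<bullet> (S *v a) = 0")
  case True
  have [measurable]: "X \<in> borel_measurable M"
    using X by (simp add: gaussian_vector_def)
  have "AE w in M. a \<bullet> X w = a \<bullet> \<mu>"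
    using X True unfolding gaussian_vector_def by metis
  then have "(\<integral>w. iexp (1 * (a \<bullet> (X w - \<mu>))) \<partial>M) = (\<integral>w. 1 \<partial>M)"
    by (intro integral_cong_AE) (auto simp: inner_diff_right)
  then show ?thesis
    using True by (simp add: char_def integral_distr prob_space)
next
  case False
  define s where "s = sqrt (a \<bullet> (S *v a))"
  have s: "s > 0" "s\<^sup>2 = a \<bullet> (S *v a)"
    using False S by (simp_all add: s_def)
  have "distributed M lborel (\<lambda>w. a \<bullet> X w) (normal_density (a \<bullet> \<mu>) s)"
    using X False unfolding gaussian_vector_def s_def by metis
  then have "distributed M lborel (\<lambda>w. (a \<bullet> X w - a \<bullet> \<mu>) / s) std_normal_density"
    by (simp only: normal_standard_normal_convert[OF s(1)])
  from char_scaled_std_normal[OF this, of s] show ?thesis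
    using s by (simp add: inner_diff_right)
qed

lemma measurable_noise_form:
  assumes "noise_assms M D N"
  shows "(\<lambda>w. noise_form D C (N w)) \<in> borel_measurable M"
proof -
  have [measurable]: "(\<lambda>w. sample (N w) i) \<in> borel_measurable M" for i
    using assms by (simp add: noise_assms_def gaussian_vector_def)
  have [measurable]: "(\<lambda>w. noise_entry \<iota> (N w)) \<in> borel_measurable M" for \<iota>
    using assms distributed_measurable[of M lborel "\<lambda>w. noise_entry \<iota> (N w)" std_normal_density]
    by (simp add: noise_assms_def)
  show ?thesis unfolding noise_form_def by measurable
qed

text \<open>Independence factors the characteristic function over samples and noise entries; each
  factor is that of a centred Gaussian.\<close>

lemma char_noise_form:
  assumes "prob_space M" and D: "query_assms D" and N: "noise_assms M D N"
  shows "char (distr M borel (\<lambda>w. noise_form D C (N w))) 1 = exp (- noise_form_variance D C / 2)"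
proof -
  interpret prob_space M by fact
  have sample [measurable]: "(\<lambda>w. sample (N w) i) \<in> borel_measurable M" for i
    using N by (simp add: noise_assms_def gaussian_vector_def)
  have entry [measurable]: "(\<lambda>w. noise_entry \<iota> (N w)) \<in> borel_measurable M" for \<iota>
    using N distributed_measurable[of M lborel "\<lambda>w. noise_entry \<iota> (N w)" std_normal_density]
    by (simp add: noise_assms_def)
  define X where "X = case_sum (\<lambda>i w. sample C i \<bullet> (sample (N w) i - mean D (label D i)))
     (\<lambda>\<iota> w. noise_entry \<iota> C * noise_entry \<iota> (N w))"
  have X_meas: "X k \<in> borel_measurable M" for k
    by (cases k) (simp_all add: X_def)
  have form: "noise_form D C (N w) = (\<Sum>k\<in>UNIV. X k w)" for w
    unfolding UNIV_Plus_UNIV[symmetric] by (simp add: sum.Plus X_def noise_form_def del: UNIV_Plus_UNIV)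
  \<comment> \<open>Each summand is a measurable function of one whole sample or one noise entry, so
    the sets it generates lie in a member of the given independent family.\<close>
  have "indep_vars (\<lambda>_. borel) X UNIV"
    unfolding indep_vars_def2
  proof (intro conjI ballI X_meas, rule indep_sets_mono_sets)
    show "indep_sets
       (case_sum
         (\<lambda>i. {(\<lambda>w. sample (N w) i) -` A \<inter> space M | A. A \<in> sets borel})
         (\<lambda>\<iota>. {(\<lambda>w. noise_entry \<iota> (N w)) -` A \<inter> space M | A. A \<in> sets borel})) UNIV"
      using N by (simp add: noise_assms_def)
    fix k
    show "{X k -` A \<inter> space M |A. A \<in> sets borel} \<subseteq> case_sum
         (\<lambda>i. {(\<lambda>w. sample (N w) i) -` A \<inter> space M | A. A \<in> sets borel})
         (\<lambda>\<iota>. {(\<lambda>w. noise_entry \<iota> (N w)) -` A \<inter> space M | A. A \<in> sets borel}) k"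
    proof (cases k)
      case (Inl i)
      have "\<exists>B. X k -` A \<inter> space M = (\<lambda>w. sample (N w) i) -` B \<inter> space M \<and> B \<in> sets borel"
        if "A \<in> sets borel" for A
      proof (intro exI conjI)
        show "X k -` A \<inter> space M = (\<lambda>w. sample (N w) i) -` ((\<lambda>x. sample C i \<bullet> (x - mean D (label D i))) -` A) \<inter> space M"
          by (simp add: Inl X_def vimage_def)
        show "(\<lambda>x. sample C i \<bullet> (x - mean D (label D i))) -` A \<in> sets borel"
          using measurable_sets[of "\<lambda>x. sample C i \<bullet> (x - mean D (label D i))" borel borel A] that by simp
      qed
      then show ?thesis by (auto simp: Inl)
    next
      case (Inr \<iota>)
      have "\<exists>B. X k -` A \<inter> space M = (\<lambda>w. noise_entry \<iota> (N w)) -` B \<inter> space M \<and> B \<in> sets borel"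
        if "A \<in> sets borel" for A
      proof (intro exI conjI)
        show "X k -` A \<inter> space M = (\<lambda>w. noise_entry \<iota> (N w)) -` ((\<lambda>x. noise_entry \<iota> C * x) -` A) \<inter> space M"
          by (simp add: Inr X_def vimage_def)
        show "(\<lambda>x. noise_entry \<iota> C * x) -` A \<in> sets borel"
          using measurable_sets[of "\<lambda>x. noise_entry \<iota> C * x" borel borel A] that by simp
      qed
      then show ?thesis by (auto simp: Inr)
    qed
  qed
  then have "char (distr M borel (\<lambda>w. noise_form D C (N w))) 1 = (\<Prod>k\<in>UNIV. char (distr M borel (X k)) 1)"
    unfolding form by (rule char_distr_sum)
  also have "\<dots> = (\<Prod>i\<in>UNIV. complex_of_real (exp (- (sample C i \<bullet> (covar D (label D i) *v sample C i)) / 2))) *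
      (\<Prod>\<iota>\<in>UNIV. complex_of_real (exp (- (noise_entry \<iota> C)\<^sup>2 / 2)))"
  proof -
    have "char (distr M borel (X (Inl i))) 1 = complex_of_real (exp (- (sample C i \<bullet> (covar D (label D i) *v sample C i)) / 2))" for i
      unfolding X_def sum.case
      by (rule char_gaussian_vector_form) (use N D in \<open>auto simp: noise_assms_def query_assms_def pos_semidef_def\<close>)
    moreover have "char (distr M borel (X (Inr \<iota>))) 1 = complex_of_real (exp (- (noise_entry \<iota> C)\<^sup>2 / 2))" for \<iota>
      unfolding X_def sum.case
      by (rule char_scaled_std_normal) (use N in \<open>simp add: noise_assms_def\<close>)
    ultimately show ?thesis
      unfolding UNIV_Plus_UNIV[symmetric] by (simp add: prod.Plus del: UNIV_Plus_UNIV)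
  qed
  also have "\<dots> = exp (- noise_form_variance D C / 2)"
    by (simp add: noise_form_variance_def exp_sum[symmetric] sum_negf sum_divide_distrib[symmetric] exp_add[symmetric]
        add_divide_distrib flip: of_real_prod of_real_mult)
  finally show ?thesis .
qed

text \<open>The characteristic function is real, so the sine integral vanishes and the addition
  formula leaves only the cosine part: the variance alone matters.\<close>

lemma integral_cos_noise_form:
  assumes "prob_space M" and "query_assms D" and N: "noise_assms M D N"
  shows "(\<integral>w. cos (noise_form D C (N w) + c) \<partial>M) = exp (- noise_form_variance D C / 2) * cos c"
proof -
  interpret prob_space M by fact
  have [measurable]: "(\<lambda>w. noise_form D C (N w)) \<in> borel_measurable M"
    by (rule measurable_noise_form[OF N])
  let ?L = "\<lambda>w. noise_form D C (N w)"
  have i: "integrable M (\<lambda>w. iexp (?L w))"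
    by (rule integrable_const_bound[of _ 1]) auto
  have "(\<integral>w. iexp (?L w) \<partial>M) = exp (- noise_form_variance D C / 2)"
    using char_noise_form[OF assms, of C] by (simp add: char_def integral_distr)
  then have "Re (\<integral>w. iexp (?L w) \<partial>M) = exp (- noise_form_variance D C / 2)" "Im (\<integral>w. iexp (?L w) \<partial>M) = 0"
    by simp_all
  then have cos_sin: "(\<integral>w. cos (?L w) \<partial>M) = exp (- noise_form_variance D C / 2)" "(\<integral>w. sin (?L w) \<partial>M) = 0"
    using i by (simp_all add: Re_exp Im_exp flip: integral_Re integral_Im)
  have "integrable M (\<lambda>w. cos (?L w))" "integrable M (\<lambda>w. sin (?L w))"
    by (rule integrable_const_bound[of _ 1]; simp)+
  then show ?thesis
    by (simp add: cos_add cos_sin)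
qed

section \<open>The variances of both maps\<close>

lemma rows_with_mult: "rows_with lab \<zeta> (A ** B) = rows_with lab \<zeta> A ** B"
  for A :: "real ^ 'k ^ 'm" and B :: "real ^ 'p ^ 'k"
  by (simp add: rows_with_def matrix_matrix_mult_def vec_eq_iff)

lemma rows_with_idem [simp]: "rows_with lab \<zeta> (rows_with lab \<zeta> A) = rows_with lab \<zeta> A"
  by (simp add: rows_with_def vec_eq_iff)

lemma rows_with_add: "rows_with lab \<zeta> (A + B) = rows_with lab \<zeta> A + rows_with lab \<zeta> B"
  for A B :: "real ^ 'k ^ 'm"
  by (simp add: rows_with_def vec_eq_iff)

lemma rows_with_scaleR: "rows_with lab \<zeta> (c *\<^sub>R A) = c *\<^sub>R rows_with lab \<zeta> A"
  for A :: "real ^ 'k ^ 'm"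
  by (simp add: rows_with_def vec_eq_iff)

lemma rows_with_assemble_rows [simp]: "rows_with lab \<zeta> (assemble_rows lab f) = rows_with lab \<zeta> (f \<zeta>)"
  by (simp add: rows_with_def assemble_rows_def vec_eq_iff)

lemma inner_assemble_rows:
  fixes lab :: "'m::finite \<Rightarrow> 'z::finite"
  shows "T \<bullet> assemble_rows lab f = (\<Sum>\<zeta>\<in>UNIV. rows_with lab \<zeta> T \<bullet> f \<zeta>)"
proof -
  have "(\<Sum>\<zeta>\<in>UNIV. rows_with lab \<zeta> T \<bullet> f \<zeta>) = (\<Sum>i\<in>UNIV. \<Sum>\<zeta>\<in>UNIV. if lab i = \<zeta> then T $ i \<bullet> f \<zeta> $ i else 0)"
    unfolding inner_vec_def[of "rows_with lab _ T"]
    by (subst sum.swap) (auto simp: rows_with_def intro!: sum.cong)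
  also have "\<dots> = T \<bullet> assemble_rows lab f"
    by (simp add: inner_vec_def[of T] assemble_rows_def)
  finally show ?thesis ..
qed

lemma inner_eq_sum_rows_with:
  fixes lab :: "'m::finite \<Rightarrow> 'z::finite"
  shows "T \<bullet> T = (\<Sum>\<zeta>\<in>UNIV. rows_with lab \<zeta> T \<bullet> rows_with lab \<zeta> T)"
proof -
  have "assemble_rows lab (\<lambda>\<zeta>. rows_with lab \<zeta> T) = T"
    by (simp add: assemble_rows_def rows_with_def vec_eq_iff)
  then show ?thesis
    using inner_assemble_rows[of T lab "\<lambda>\<zeta>. rows_with lab \<zeta> T"] by simp
qed

lemma inner_eq_sum_column: "A \<bullet> B = (\<Sum>i\<in>UNIV. column i A \<bullet> column i B)"
  for A B :: "real ^ 'k ^ 'n"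
  by (simp add: inner_vec_def column_def) (rule sum.swap)

lemma column_matrix_mult: "column i (A ** B) = A *v column i B"
  for A :: "real ^ 'k ^ 'n" and B :: "real ^ 'p ^ 'k"
  by (simp add: column_def matrix_matrix_mult_def matrix_vector_mult_def vec_eq_iff)

text \<open>Sample \<open>i\<close> has the covariance of its label; grouping columns by label makes
  the sample variance comparable with the other terms, which are sums over labels.\<close>

lemma sum_column_quadratic_form:
  fixes lab :: "'m::finite \<Rightarrow> 'z::finite" and R :: "'z \<Rightarrow> real ^ 'n ^ 'n" and C :: "real ^ 'm ^ 'n"
  defines "C' \<equiv> \<lambda>\<zeta>. transpose (rows_with lab \<zeta> (transpose C))"
  shows "(\<Sum>i\<in>UNIV. column i C \<bullet> (R (lab i) *v column i C)) = (\<Sum>\<zeta>\<in>UNIV. C' \<zeta> \<bullet> (R \<zeta> ** C' \<zeta>))"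
proof -
  have col: "column i (C' \<zeta>) = (if lab i = \<zeta> then column i C else 0)" for i \<zeta>
    by (simp add: C'_def column_def transpose_def rows_with_def vec_eq_iff)
  have "(\<Sum>\<zeta>\<in>UNIV. C' \<zeta> \<bullet> (R \<zeta> ** C' \<zeta>)) =
      (\<Sum>i\<in>UNIV. \<Sum>\<zeta>\<in>UNIV. if lab i = \<zeta> then column i C \<bullet> (R \<zeta> *v column i C) else 0)"
    unfolding inner_eq_sum_column column_matrix_mult col
    by (subst sum.swap) (auto intro!: sum.cong)
  also have "\<dots> = (\<Sum>i\<in>UNIV. column i C \<bullet> (R (lab i) *v column i C))"
    by simp
  finally show ?thesis ..
qed

text \<open>The adjoint, applied to \<open>S\<close>, of the map sending \<open>E\<close> to R Theta
  times the inverse of A_theta times the upper part of \<open>E\<close>. It is the \<open>U\<close>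
  of \<open>variance_identity\<close>.\<close>

definition theta_dual ::
  "('n::finite, 'm::finite, 'l::{finite,linorder}, 'j::finite, 'z, 'y) query_data
     \<Rightarrow> real \<Rightarrow> ('n, 'm, 'l, 'j) state \<Rightarrow> real ^ ('l \<times> 'j) ^ 'n \<Rightarrow> 'z \<Rightarrow> ('l, 'j) sqblock" where
  "theta_dual D \<sigma> \<xi> S \<zeta> =
     upper_part (transpose (matrix_inv (A_theta D \<sigma> \<zeta> \<xi>)) ** (transpose (Theta D \<xi>) ** covar D \<zeta> ** S))"

text \<open>The analogous adjoint for the lower component, the \<open>L\<close> of
  \<open>variance_identity\<close>. The outer transpose reflects that \<open>W\<close> and \<Gamma>
  enter that component transposed, so both contributions to a coefficient can be added.\<close>

definition omega_dual ::
  "('n::finite, 'm::finite, 'l::{finite,linorder}, 'j::finite, 'z, 'y) query_data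
     \<Rightarrow> real \<Rightarrow> ('n, 'm, 'l, 'j) state \<Rightarrow> real ^ ('l \<times> 'j) ^ 'm \<Rightarrow> 'z \<Rightarrow> ('l, 'j) sqblock" where
  "omega_dual D \<sigma> \<xi> T \<zeta> =
     transpose (strict_upper_part (transpose (matrix_inv (A_omega D \<sigma> \<zeta> \<xi>)) **
       (transpose (Omega_sub D \<zeta> \<xi>) ** rows_with (label D) \<zeta> T)))"

definition Gamma_coeff ::
  "('n::finite, 'm::finite, 'l::{finite,linorder}, 'j::finite, 'z, 'y) query_data
     \<Rightarrow> real \<Rightarrow> ('n, 'm, 'l, 'j) state \<Rightarrow> ('n, 'm, 'l, 'j) state \<Rightarrow> 'z \<Rightarrow> ('l, 'j) sqblock" where
  "Gamma_coeff D \<sigma> \<xi> \<tau> \<zeta> =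
     theta_dual D \<sigma> \<xi> (fst \<tau>) \<zeta> ** transpose (A_omega D \<sigma> \<zeta> \<xi>) +
     A_theta D \<sigma> \<zeta> \<xi> ** omega_dual D \<sigma> \<xi> (snd \<tau>) \<zeta>"

text \<open>G, H, W and \<Gamma> each occur in both components of \<open>psi\<close>, so each
  coefficient has one term from \<open>fst \<tau>\<close> and one from \<open>snd \<tau>\<close>. Up
  to scaling they are \<open>E\<close>, \<open>F\<close>, \<open>U + L\<close> and \<open>G\<close>
  of \<open>variance_identity\<close>.\<close>

definition psi_coeff ::
  "('n::finite, 'm::finite, 'l::{finite,linorder}, 'j::finite, 'z, 'y) query_data
     \<Rightarrow> real \<Rightarrow> real \<Rightarrow> ('n, 'm, 'l, 'j) state \<Rightarrow> ('n, 'm, 'l, 'j) state \<Rightarrow> ('n, 'm, 'l, 'j, 'z) noise" where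
  "psi_coeff D \<sigma> z \<xi> \<tau> =
    \<lparr>sample = (\<lambda>_. 0), noise_U = (\<lambda>_. 0), noise_V = 0,
     noise_G = (\<lambda>\<zeta>. (1 / sqrt (real CARD('m))) *\<^sub>R
       (covar_root D \<zeta> ** fst \<tau> ** transpose (A_omega D \<sigma> \<zeta> \<xi>) +
        covar_root D \<zeta> ** Theta D \<xi> ** omega_dual D \<sigma> \<xi> (snd \<tau>) \<zeta>)),
     noise_H = assemble_rows (label D) (\<lambda>\<zeta>.
       rows_with (label D) \<zeta> (snd \<tau>) ** transpose (A_theta D \<sigma> \<zeta> \<xi>) +
       (1 / real CARD('m)) *\<^sub>R (Omega_sub D \<zeta> \<xi> ** transpose (theta_dual D \<sigma> \<xi> (fst \<tau>) \<zeta>))),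
     noise_W = (\<lambda>\<zeta>. (\<sigma> / sqrt (real CARD('m))) *\<^sub>R
       (theta_dual D \<sigma> \<xi> (fst \<tau>) \<zeta> + omega_dual D \<sigma> \<xi> (snd \<tau>) \<zeta>)),
     noise_Gamma = (\<lambda>\<zeta>. (z / sqrt (real CARD('m))) *\<^sub>R Gamma_coeff D \<sigma> \<xi> \<tau> \<zeta>)\<rparr>"

text \<open>\<open>Xtilde\<close> occurs in both components, once transposed. Moving the other
  factors across the inner product gives a single coefficient matrix, whose column \<open>i\<close>
  belongs to sample \<open>i\<close>.\<close>

definition phi'_coeff ::
  "('n::finite, 'm::finite, 'l::{finite,linorder}, 'j::finite, 'z, 'y) query_data
     \<Rightarrow> real \<Rightarrow> real \<Rightarrow> ('n, 'm, 'l, 'j) state \<Rightarrow> ('n, 'm, 'l, 'j) state \<Rightarrow> ('n, 'm, 'l, 'j, 'z) noise" where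
  "phi'_coeff D \<sigma> z \<xi> \<tau> =
    \<lparr>sample = (\<lambda>i. column i
       ((1 / real CARD('m)) *\<^sub>R (fst \<tau> ** transpose (Omega D \<xi>)) + Theta D \<xi> ** transpose (snd \<tau>))),
     noise_U = (\<lambda>\<zeta>. (\<sigma> / sqrt (real CARD('m))) *\<^sub>R (covar_root D \<zeta> ** fst \<tau>)),
     noise_V = \<sigma> *\<^sub>R snd \<tau>,
     noise_G = (\<lambda>_. 0), noise_H = 0, noise_W = (\<lambda>_. 0),
     noise_Gamma = (\<lambda>\<zeta>. sqrt ((1 + z\<^sup>2) / real CARD('m)) *\<^sub>R Gamma_coeff D \<sigma> \<xi> \<tau> \<zeta>)\<rparr>"

context
  fixes D :: "('n::finite, 'm::finite, 'l::{finite,linorder}, 'j::finite, 'z::finite, 'y) query_data"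
  assumes D: "query_assms D"
begin

lemma covar_transpose: "transpose (covar D \<zeta>) = covar D \<zeta>"
  and covar_root_transpose: "transpose (covar_root D \<zeta>) = covar_root D \<zeta>"
  and covar_root_square: "covar_root D \<zeta> ** covar_root D \<zeta> = covar D \<zeta>"
  using D by (auto simp: query_assms_def pos_semidef_def)

lemma inner_theta_term:
  "S \<bullet> (covar D \<zeta> ** Theta D \<xi> ** matrix_inv (A_theta D \<sigma> \<zeta> \<xi>) ** upper_part E) = theta_dual D \<sigma> \<xi> S \<zeta> \<bullet> E"
proof -
  have "S \<bullet> (covar D \<zeta> ** Theta D \<xi> ** matrix_inv (A_theta D \<sigma> \<zeta> \<xi>) ** upper_part E) =
    upper_part E \<bullet> (transpose (matrix_inv (A_theta D \<sigma> \<zeta> \<xi>)) ** (transpose (Theta D \<xi>) ** covar D \<zeta> ** S))"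
    by (subst inner_commute) (simp add: inner_matrix_mult_left covar_transpose flip: matrix_mul_assoc)
  then show ?thesis
    by (simp add: theta_dual_def inner_upper_part inner_commute)
qed

lemma inner_omega_term:
  "rows_with (label D) \<zeta> T \<bullet> (Omega_sub D \<zeta> \<xi> ** matrix_inv (A_omega D \<sigma> \<zeta> \<xi>) ** strict_upper_part E) =
    omega_dual D \<sigma> \<xi> T \<zeta> \<bullet> transpose E"
proof -
  have "rows_with (label D) \<zeta> T \<bullet> (Omega_sub D \<zeta> \<xi> ** matrix_inv (A_omega D \<sigma> \<zeta> \<xi>) ** strict_upper_part E) =
    strict_upper_part E \<bullet> (transpose (matrix_inv (A_omega D \<sigma> \<zeta> \<xi>)) ** (transpose (Omega_sub D \<zeta> \<xi>) ** rows_with (label D) \<zeta> T))"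
    by (subst inner_commute) (simp add: inner_matrix_mult_left flip: matrix_mul_assoc)
  then show ?thesis
    by (simp add: omega_dual_def inner_transpose_transpose inner_strict_upper_part inner_commute)
qed

lemma inner_Gamma_term:
  "theta_dual D \<sigma> \<xi> S \<zeta> \<bullet> (E ** A_omega D \<sigma> \<zeta> \<xi>) +
   omega_dual D \<sigma> \<xi> T \<zeta> \<bullet> transpose (transpose E ** A_theta D \<sigma> \<zeta> \<xi>) = Gamma_coeff D \<sigma> \<xi> (S, T) \<zeta> \<bullet> E"
proof -
  have "theta_dual D \<sigma> \<xi> S \<zeta> \<bullet> (E ** A_omega D \<sigma> \<zeta> \<xi>) = (theta_dual D \<sigma> \<xi> S \<zeta> ** transpose (A_omega D \<sigma> \<zeta> \<xi>)) \<bullet> E"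
    by (simp add: inner_matrix_mult_right)
  moreover have "omega_dual D \<sigma> \<xi> T \<zeta> \<bullet> transpose (transpose E ** A_theta D \<sigma> \<zeta> \<xi>) = (A_theta D \<sigma> \<zeta> \<xi> ** omega_dual D \<sigma> \<xi> T \<zeta>) \<bullet> E"
    by (simp add: matrix_transpose_mul inner_matrix_mult_left)
  ultimately show ?thesis
    by (simp add: Gamma_coeff_def inner_add_left)
qed

lemma inner_psi: "\<tau> \<bullet> psi D \<sigma> z N \<xi> = noise_form D (psi_coeff D \<sigma> z \<xi> \<tau>) N"
proof -
  obtain S T where \<tau>: "\<tau> = (S, T)" by (cases \<tau>)
  define q where "q = 1 / sqrt (real CARD('m))"
  define c where "c = 1 / real CARD('m)"
  let ?U = "theta_dual D \<sigma> \<xi> S" and ?L = "omega_dual D \<sigma> \<xi> T"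
  let ?A = "\<lambda>\<zeta>. A_theta D \<sigma> \<zeta> \<xi>" and ?B = "\<lambda>\<zeta>. A_omega D \<sigma> \<zeta> \<xi>"
  let ?r = "rows_with (label D)"
  have G: "S \<bullet> (covar_root D \<zeta> ** (q *\<^sub>R noise_G N \<zeta>) ** ?B \<zeta>) =
      q * ((covar_root D \<zeta> ** S ** transpose (?B \<zeta>)) \<bullet> noise_G N \<zeta>)" for \<zeta>
  proof -
    have "S \<bullet> (covar_root D \<zeta> ** noise_G N \<zeta> ** ?B \<zeta>) = (covar_root D \<zeta> ** (noise_G N \<zeta> ** ?B \<zeta>)) \<bullet> S"
      by (simp add: inner_commute matrix_mul_assoc)
    also have "\<dots> = (noise_G N \<zeta> ** ?B \<zeta>) \<bullet> (covar_root D \<zeta> ** S)"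
      by (simp add: inner_matrix_mult_left covar_root_transpose)
    also have "\<dots> = noise_G N \<zeta> \<bullet> (covar_root D \<zeta> ** S ** transpose (?B \<zeta>))"
      by (rule inner_matrix_mult_right)
    finally show ?thesis
      by (simp add: matrix_scaleR_left matrix_scaleR_right inner_commute)
  qed
  have G': "?L \<zeta> \<bullet> transpose (transpose (noise_G N \<zeta>) ** covar_root D \<zeta> ** Theta D \<xi>) =
      (covar_root D \<zeta> ** Theta D \<xi> ** ?L \<zeta>) \<bullet> noise_G N \<zeta>" for \<zeta>
    by (simp add: matrix_transpose_mul covar_root_transpose inner_matrix_mult_left flip: matrix_mul_assoc)
  have H: "?U \<zeta> \<bullet> (transpose (?r \<zeta> (noise_H N)) ** Omega_sub D \<zeta> \<xi>) =
      (Omega_sub D \<zeta> \<xi> ** transpose (?U \<zeta>)) \<bullet> ?r \<zeta> (noise_H N)" for \<zeta>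
    by (subst inner_transpose_transpose[symmetric])
      (simp add: matrix_transpose_mul inner_matrix_mult_left)
  have H': "?r \<zeta> T \<bullet> (?r \<zeta> (noise_H N) ** ?A \<zeta>) = (?r \<zeta> T ** transpose (?A \<zeta>)) \<bullet> ?r \<zeta> (noise_H N)" for \<zeta>
    by (simp add: inner_matrix_mult_right)
  have sum_H: "assemble_rows (label D) f \<bullet> noise_H N = (\<Sum>\<zeta>\<in>UNIV. f \<zeta> \<bullet> ?r \<zeta> (noise_H N))" for f
    by (subst inner_commute) (simp add: inner_assemble_rows inner_commute)
  have Gam: "q * (z * (?U \<zeta> \<bullet> (noise_Gamma N \<zeta> ** ?B \<zeta>))) + q * (z * (?L \<zeta> \<bullet> transpose (transpose (noise_Gamma N \<zeta>) ** ?A \<zeta>))) =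
      q * (z * (Gamma_coeff D \<sigma> \<xi> \<tau> \<zeta> \<bullet> noise_Gamma N \<zeta>))" for \<zeta>
    unfolding \<tau> inner_Gamma_term[symmetric] distrib_left ..
  have "\<tau> \<bullet> psi D \<sigma> z N \<xi> =
      (\<Sum>\<zeta>\<in>UNIV. q * ((covar_root D \<zeta> ** S ** transpose (?B \<zeta>)) \<bullet> noise_G N \<zeta>)
        + c * ((Omega_sub D \<zeta> \<xi> ** transpose (?U \<zeta>)) \<bullet> ?r \<zeta> (noise_H N))
        + q * (\<sigma> * (?U \<zeta> \<bullet> noise_W N \<zeta>) + z * (?U \<zeta> \<bullet> (noise_Gamma N \<zeta> ** ?B \<zeta>)))
        + (?r \<zeta> T ** transpose (?A \<zeta>)) \<bullet> ?r \<zeta> (noise_H N)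
        + q * ((covar_root D \<zeta> ** Theta D \<xi> ** ?L \<zeta>) \<bullet> noise_G N \<zeta> + \<sigma> * (?L \<zeta> \<bullet> noise_W N \<zeta>)
          + z * (?L \<zeta> \<bullet> transpose (transpose (noise_Gamma N \<zeta>) ** ?A \<zeta>))))"
    unfolding \<tau> psi_def inner_Pair q_def[symmetric] c_def[symmetric]
    by (simp add: inner_add_right inner_sum_right inner_assemble_rows inner_theta_term inner_omega_term
        G G' H H' transpose_add transpose_scalar sum.distrib algebra_simps)
  also have "\<dots> = (\<Sum>\<zeta>\<in>UNIV.
      (q *\<^sub>R (covar_root D \<zeta> ** S ** transpose (?B \<zeta>) + covar_root D \<zeta> ** Theta D \<xi> ** ?L \<zeta>)) \<bullet> noise_G N \<zeta>
      + (?r \<zeta> T ** transpose (?A \<zeta>) + c *\<^sub>R (Omega_sub D \<zeta> \<xi> ** transpose (?U \<zeta>))) \<bullet> ?r \<zeta> (noise_H N)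
      + ((\<sigma> * q) *\<^sub>R (?U \<zeta> + ?L \<zeta>)) \<bullet> noise_W N \<zeta>
      + ((z * q) *\<^sub>R Gamma_coeff D \<sigma> \<xi> \<tau> \<zeta>) \<bullet> noise_Gamma N \<zeta>)"
    apply (intro sum.cong refl)
    subgoal for \<zeta> using Gam[of \<zeta>] by (simp add: inner_add_left algebra_simps)
    done
  also have "\<dots> = noise_form D (psi_coeff D \<sigma> z \<xi> \<tau>) N"
    by (simp add: noise_form_eq psi_coeff_def sum_H sum.distrib \<tau> q_def c_def)
  finally show ?thesis .
qed

lemma inner_phi': "\<tau> \<bullet> phi' D \<sigma> z N \<xi> = noise_form D (phi'_coeff D \<sigma> z \<xi> \<tau>) N"
proof -
  obtain S T where \<tau>: "\<tau> = (S, T)" by (cases \<tau>)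
  define k where "k = sqrt ((1 + z\<^sup>2) / real CARD('m))"
  let ?C = "(1 / real CARD('m)) *\<^sub>R (S ** transpose (Omega D \<xi>)) + Theta D \<xi> ** transpose T"
  have "T \<bullet> (transpose (Xtilde D N) ** Theta D \<xi>) = (Theta D \<xi> ** transpose T) \<bullet> Xtilde D N"
    by (subst inner_transpose_transpose[symmetric])
      (simp add: matrix_transpose_mul inner_matrix_mult_left)
  then have X: "(S, T) \<bullet> phi D N \<xi> = (\<Sum>i\<in>UNIV. column i ?C \<bullet> (sample N i - mean D (label D i)))"
  proof -
    have "(\<Sum>i\<in>UNIV. column i ?C \<bullet> (sample N i - mean D (label D i))) = ?C \<bullet> Xtilde D N"
    proof -
      have "column i (Xtilde D N) = sample N i - mean D (label D i)" for i
        by (simp add: column_def Xtilde_def vec_eq_iff)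
      then show ?thesis by (simp add: inner_eq_sum_column[of ?C])
    qed
    then show ?thesis
      using \<open>T \<bullet> _ = _\<close> by (simp add: phi_def inner_add_left inner_matrix_mult_right)
  qed
  have U: "S \<bullet> (covar_root D \<zeta> ** noise_U N \<zeta>) = (covar_root D \<zeta> ** S) \<bullet> noise_U N \<zeta>" for \<zeta>
    by (simp add: inner_matrix_mult_left[of _ S] covar_root_transpose)
  have Gam: "(S, T) \<bullet> (\<Sum>\<zeta>\<in>UNIV. covar D \<zeta> ** Theta D \<xi> ** matrix_inv (A_theta D \<sigma> \<zeta> \<xi>)
            ** upper_part (noise_Gamma N \<zeta> ** A_omega D \<sigma> \<zeta> \<xi>),
         assemble_rows (label D) (\<lambda>\<zeta>. Omega_sub D \<zeta> \<xi> ** matrix_inv (A_omega D \<sigma> \<zeta> \<xi>)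
            ** strict_upper_part (transpose (noise_Gamma N \<zeta>) ** A_theta D \<sigma> \<zeta> \<xi>))) =
      (\<Sum>\<zeta>\<in>UNIV. Gamma_coeff D \<sigma> \<xi> \<tau> \<zeta> \<bullet> noise_Gamma N \<zeta>)"
    by (simp add: inner_Pair inner_sum_right inner_theta_term inner_assemble_rows inner_omega_term \<tau>
        flip: inner_Gamma_term sum.distrib)
  show ?thesis
    unfolding phi'_def inner_add_right inner_scaleR_right k_def[symmetric] noise_form_eq
    by (simp only: \<tau> X Gam[unfolded \<tau>])
      (simp add: phi'_coeff_def inner_sum_right U sum_distrib_left distrib_left k_def)
qed

text \<open>\<open>variance_identity\<close> summed over the labels: it yields the \<Gamma> norm
  with weight \<open>c\<close>, to which \<open>psi\<close> adds weight z^2 times \<open>c\<close>;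
  together this is the squared factor in \<open>phi'\<close>.\<close>

lemma noise_form_variance_eq_psi_phi':
  assumes \<sigma>: "\<sigma> > 0"
  shows "noise_form_variance D (psi_coeff D \<sigma> z \<xi> \<tau>) = noise_form_variance D (phi'_coeff D \<sigma> z \<xi> \<tau>)"
proof -
  obtain S T where \<tau>: "\<tau> = (S, T)" by (cases \<tau>)
  define c where "c = 1 / real CARD('m)"
  let ?U = "theta_dual D \<sigma> \<xi> S" and ?L = "omega_dual D \<sigma> \<xi> T" and ?G = "Gamma_coeff D \<sigma> \<xi> \<tau>"
  let ?A = "\<lambda>\<zeta>. A_theta D \<sigma> \<zeta> \<xi>" and ?B = "\<lambda>\<zeta>. A_omega D \<sigma> \<zeta> \<xi>"
  let ?r = "rows_with (label D)" and ?\<Omega> = "\<lambda>\<zeta>. Omega_sub D \<zeta> \<xi>"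
  define E where "E = (\<lambda>\<zeta>. covar_root D \<zeta> ** S ** transpose (?B \<zeta>) + covar_root D \<zeta> ** Theta D \<xi> ** ?L \<zeta>)"
  define F where "F = (\<lambda>\<zeta>. ?r \<zeta> T ** transpose (?A \<zeta>) + c *\<^sub>R (?\<Omega> \<zeta> ** transpose (?U \<zeta>)))"
  define C where "C = (\<lambda>\<zeta>. c *\<^sub>R (S ** transpose (?\<Omega> \<zeta>)) + Theta D \<xi> ** transpose (?r \<zeta> T))"
  have c: "c \<ge> 0" "(1 / sqrt (real CARD('m))) * (1 / sqrt (real CARD('m))) = c"
    by (simp_all add: c_def)
  have identity: "c * (E \<zeta> \<bullet> E \<zeta>) + F \<zeta> \<bullet> F \<zeta> + c * \<sigma>\<^sup>2 * ((?U \<zeta> + ?L \<zeta>) \<bullet> (?U \<zeta> + ?L \<zeta>)) =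
      C \<zeta> \<bullet> (covar D \<zeta> ** C \<zeta>) + c * \<sigma>\<^sup>2 * ((covar_root D \<zeta> ** S) \<bullet> (covar_root D \<zeta> ** S))
      + \<sigma>\<^sup>2 * (?r \<zeta> T \<bullet> ?r \<zeta> T) + c * (?G \<zeta> \<bullet> ?G \<zeta>)" for \<zeta>
    unfolding E_def F_def C_def Gamma_coeff_def \<tau> fst_conv snd_conv theta_dual_def omega_dual_def
  proof (rule variance_identity)
    \<comment> \<open>This identifies the matrices inside \<open>theta_dual\<close> and
      \<open>omega_dual\<close> as the \<open>X\<close> and \<open>Y\<close> of
      \<open>variance_identity\<close>.\<close>
    have A: "transpose (?A \<zeta>) ** transpose (matrix_inv (?A \<zeta>)) = mat 1"
      "transpose (?B \<zeta>) ** transpose (matrix_inv (?B \<zeta>)) = mat 1"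
      using A_theta_props(3)[OF D \<sigma>, of \<zeta> \<xi>] A_omega_props(3)[OF D \<sigma>, of \<zeta> \<xi>]
      by (simp_all add: matrix_inv_mult transpose_mat flip: matrix_transpose_mul)
    then show "transpose (?A \<zeta>) ** (transpose (matrix_inv (?A \<zeta>)) ** (transpose (Theta D \<xi>) ** covar D \<zeta> ** S)) =
        transpose (Theta D \<xi>) ** covar D \<zeta> ** S"
      "transpose (?B \<zeta>) ** (transpose (matrix_inv (?B \<zeta>)) ** (transpose (?\<Omega> \<zeta>) ** ?r \<zeta> T)) =
        transpose (?\<Omega> \<zeta>) ** ?r \<zeta> T"
      by (simp_all add: matrix_mul_assoc)
    show "transpose (?A \<zeta>) ** ?A \<zeta> = transpose (Theta D \<xi>) ** covar D \<zeta> ** Theta D \<xi> + \<sigma>\<^sup>2 *\<^sub>R mat 1"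
      using A_theta_props(2)[OF D \<sigma>, of \<zeta> \<xi>] by (simp add: V_theta_def)
    show "transpose (?B \<zeta>) ** ?B \<zeta> = c *\<^sub>R (transpose (?\<Omega> \<zeta>) ** ?\<Omega> \<zeta>) + \<sigma>\<^sup>2 *\<^sub>R mat 1"
      using A_omega_props(2)[OF D \<sigma>, of \<zeta> \<xi>] by (simp add: V_omega_def c_def)
  qed (simp_all add: covar_root_transpose covar_root_square A_theta_props[OF D \<sigma>] A_omega_props[OF D \<sigma>])
  \<comment> \<open>\<open>F \<zeta>\<close> lives on the rows labelled \<zeta>, so assembling adds
    squared norms.\<close>
  have F_rows: "?r \<zeta> (F \<zeta>) = F \<zeta>" for \<zeta>
    by (simp add: F_def rows_with_add rows_with_scaleR rows_with_mult Omega_sub_def)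
  have "assemble_rows (label D) F \<bullet> assemble_rows (label D) F = (\<Sum>\<zeta>\<in>UNIV. F \<zeta> \<bullet> F \<zeta>)"
    by (simp add: inner_assemble_rows F_rows)
  then have "noise_form_variance D (psi_coeff D \<sigma> z \<xi> \<tau>) =
      (\<Sum>\<zeta>\<in>UNIV. c * (E \<zeta> \<bullet> E \<zeta>) + F \<zeta> \<bullet> F \<zeta> + c * \<sigma>\<^sup>2 * ((?U \<zeta> + ?L \<zeta>) \<bullet> (?U \<zeta> + ?L \<zeta>)) + z\<^sup>2 * (c * (?G \<zeta> \<bullet> ?G \<zeta>)))"
    unfolding noise_form_variance_eq psi_coeff_def
    by (simp add: \<tau> sum.distrib power2_eq_square c_def E_def F_def mult.assoc)
  also have "\<dots> = (\<Sum>\<zeta>\<in>UNIV. C \<zeta> \<bullet> (covar D \<zeta> ** C \<zeta>) + c * \<sigma>\<^sup>2 * ((covar_root D \<zeta> ** S) \<bullet> (covar_root D \<zeta> ** S))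
      + \<sigma>\<^sup>2 * (?r \<zeta> T \<bullet> ?r \<zeta> T) + ((1 + z\<^sup>2) * c) * (?G \<zeta> \<bullet> ?G \<zeta>))"
    by (simp only: identity) (simp add: algebra_simps)
  also have "\<dots> = noise_form_variance D (phi'_coeff D \<sigma> z \<xi> \<tau>)"
  proof -
    let ?C = "c *\<^sub>R (S ** transpose (Omega D \<xi>)) + Theta D \<xi> ** transpose T"
    have "transpose (?r \<zeta> (transpose ?C)) = C \<zeta>" for \<zeta>
      by (simp add: C_def transpose_add transpose_scalar matrix_transpose_mul rows_with_add rows_with_scaleR
          rows_with_mult Omega_sub_def)
    then have "(\<Sum>i\<in>UNIV. column i ?C \<bullet> (covar D (label D i) *v column i ?C)) = (\<Sum>\<zeta>\<in>UNIV. C \<zeta> \<bullet> (covar D \<zeta> ** C \<zeta>))"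
      by (simp only: sum_column_quadratic_form)
    moreover have "sqrt ((1 + z\<^sup>2) / real CARD('m)) * sqrt ((1 + z\<^sup>2) / real CARD('m)) = (1 + z\<^sup>2) * c"
      by (simp add: c_def)
    moreover have "T \<bullet> T = (\<Sum>\<zeta>\<in>UNIV. ?r \<zeta> T \<bullet> ?r \<zeta> T)"
      by (rule inner_eq_sum_rows_with)
    ultimately show ?thesis
      unfolding noise_form_variance_eq phi'_coeff_def
      by (simp add: \<tau> sum.distrib power2_eq_square sum_distrib_left flip: c_def mult.assoc)
        (simp add: c_def)
  qed
  finally show ?thesis .
qed

end

section \<open>Solutions of the equations\<close>

text \<open>The rank of a time, which turns the abstract order of times into numbered
  stages.\<close>

definition time_index :: "'l::{finite,linorder} \<Rightarrow> nat" where
  "time_index l = card {k. k < l}"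

lemma time_index_mono: "k < l \<Longrightarrow> time_index k < time_index l"
  unfolding time_index_def by (intro psubset_card_mono) auto

lemma time_index_less: "time_index l < CARD('l)" for l :: "'l::{finite,linorder}"
  unfolding time_index_def by (intro psubset_card_mono) auto

text \<open>Stage \<open>2 l\<close> computes \<open>p(l)\<close> and stage \<open>2 l + 1\<close> computes \<open>q(l)\<close>.\<close>

definition agree_before ::
  "nat \<Rightarrow> ('n::finite, 'm::finite, 'l::{finite,linorder}, 'j::finite) state \<Rightarrow> ('n, 'm, 'l, 'j) state \<Rightarrow> bool" where
  "agree_before s \<xi> \<xi>' \<longleftrightarrow>
     (\<forall>l. 2 * time_index l < s \<longrightarrow> (\<forall>i j. snd \<xi> $ i $ (l, j) = snd \<xi>' $ i $ (l, j))) \<and>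
     (\<forall>l. 2 * time_index l + 1 < s \<longrightarrow> (\<forall>a j. fst \<xi> $ a $ (l, j) = fst \<xi>' $ a $ (l, j)))"

lemma grid_round_state:
  fixes \<xi> :: "('n::finite, 'm::finite, 'l::finite, 'j::finite) state"
  shows "fst (grid_round n \<xi>) $ a $ k = of_int \<lfloor>real (Suc n) * fst \<xi> $ a $ k\<rfloor> / real (Suc n)"
    and "snd (grid_round n \<xi>) $ i $ k = of_int \<lfloor>real (Suc n) * snd \<xi> $ i $ k\<rfloor> / real (Suc n)"
proof -
  have Q: "(axis a (axis k 1), 0) \<in> (Basis :: ('n, 'm, 'l, 'j) state set)"
    and P: "(0, axis i (axis k 1)) \<in> (Basis :: ('n, 'm, 'l, 'j) state set)"
    by (simp_all add: Basis_prod_def axis_in_Basis_iff)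
  show "fst (grid_round n \<xi>) $ a $ k = of_int \<lfloor>real (Suc n) * fst \<xi> $ a $ k\<rfloor> / real (Suc n)"
    using grid_round_inner[OF Q, of n \<xi>] by (simp add: inner_prod_def inner_axis del: grid_round_inner)
  show "snd (grid_round n \<xi>) $ i $ k = of_int \<lfloor>real (Suc n) * snd \<xi> $ i $ k\<rfloor> / real (Suc n)"
    using grid_round_inner[OF P, of n \<xi>] by (simp add: inner_prod_def inner_axis del: grid_round_inner)
qed

lemma staged_space_state:
  "staged_space (agree_before :: nat \<Rightarrow> ('n::finite, 'm::finite, 'l::{finite,linorder}, 'j::finite) state \<Rightarrow> _)
     (2 * CARD('l) + 1)"
proof
  fix \<xi> \<xi>' :: "('n, 'm, 'l, 'j) state" and s n
  show "agree_before 0 \<xi> \<xi>'"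
    by (simp add: agree_before_def)
  \<comment> \<open>The last stage, q at time L - 1, has number 2 L - 1.\<close>
  have "2 * time_index l < 2 * CARD('l) + 1" "2 * time_index l + 1 < 2 * CARD('l) + 1" for l :: 'l
    using time_index_less[of l] by simp_all
  then show "\<xi> = \<xi>'" if "agree_before (2 * CARD('l) + 1) \<xi> \<xi>'"
    using that unfolding agree_before_def by (auto simp: prod_eq_iff vec_eq_iff)
  show "agree_before s (grid_round n \<xi>) (grid_round n \<xi>')" if "agree_before s \<xi> \<xi>'"
    using that by (simp add: agree_before_def grid_round_state del: of_nat_Suc)
qed

text \<open>Columnwise causality in the order p(l), q(l) becomes causality in the stage counter:
  p(l) reads the stages below 2 l, and q(l) reads in addition stage 2 l, which is p(l).\<close>

lemma causal_agree_beforeI: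
  fixes g :: "('n::finite, 'm::finite, 'l::{finite,linorder}, 'j::finite) state \<Rightarrow> ('n, 'm, 'l, 'j) state"
  assumes P: "\<And>l \<xi> \<xi>'. same_cols_lt l (fst \<xi>) (fst \<xi>') \<Longrightarrow> same_cols_lt l (snd \<xi>) (snd \<xi>') \<Longrightarrow>
      same_cols_le l (snd (g \<xi>)) (snd (g \<xi>'))"
    and Q: "\<And>l \<xi> \<xi>'. same_cols_lt l (fst \<xi>) (fst \<xi>') \<Longrightarrow> same_cols_le l (snd \<xi>) (snd \<xi>') \<Longrightarrow>
      same_cols_le l (fst (g \<xi>)) (fst (g \<xi>'))"
  shows "causal agree_before g"
  unfolding causal_def
proof (intro allI impI)
  fix s and \<xi> \<xi>' :: "('n, 'm, 'l, 'j) state" assume agree: "agree_before s \<xi> \<xi>'"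
  have Q_lt: "same_cols_lt l (fst \<xi>) (fst \<xi>')" if "2 * time_index l \<le> s" for l
  proof -
    have "2 * time_index k + 1 < s" if "k < l" for k
      using time_index_mono[OF that] \<open>2 * time_index l \<le> s\<close> by simp
    then show ?thesis using agree by (simp add: agree_before_def same_cols_lt_def)
  qed
  have P_lt: "same_cols_lt l (snd \<xi>) (snd \<xi>')" if "2 * time_index l \<le> s" for l
  proof -
    have "2 * time_index k < s" if "k < l" for k
      using time_index_mono[OF that] \<open>2 * time_index l \<le> s\<close> by simp
    then show ?thesis using agree by (simp add: agree_before_def same_cols_lt_def)
  qed
  have P_le: "same_cols_le l (snd \<xi>) (snd \<xi>')" if "2 * time_index l + 1 \<le> s" for l
  proof -
    have "2 * time_index k < s" if "k \<le> l" for k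
      using time_index_mono[of k l] that \<open>2 * time_index l + 1 \<le> s\<close> by (auto simp: le_less)
    then show ?thesis using agree by (simp add: agree_before_def same_cols_le_def)
  qed
  show "agree_before (Suc s) (g \<xi>) (g \<xi>')"
    unfolding agree_before_def
  proof (intro conjI allI impI)
    fix l :: 'l and i j assume "2 * time_index l < Suc s"
    then have "same_cols_le l (snd (g \<xi>)) (snd (g \<xi>'))"
      by (intro P Q_lt P_lt) auto
    then show "snd (g \<xi>) $ i $ (l, j) = snd (g \<xi>') $ i $ (l, j)"
      by (simp add: same_cols_le_D)
  next
    fix l :: 'l and a j assume "2 * time_index l + 1 < Suc s"
    then have "same_cols_le l (fst (g \<xi>)) (fst (g \<xi>'))"
      by (intro Q Q_lt P_le) auto
    then show "fst (g \<xi>) $ a $ (l, j) = fst (g \<xi>') $ a $ (l, j)"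
      by (simp add: same_cols_le_D)
  qed
qed

lemma measurable_if_noise_form:
  fixes f :: "'a \<Rightarrow> 'e::euclidean_space"
  assumes N: "noise_assms M D N" and form: "\<And>\<tau> w. \<tau> \<bullet> f w = noise_form D (C \<tau>) (N w)"
  shows "f \<in> borel_measurable M"
  unfolding borel_measurable_euclidean_space[of f]
  by (subst inner_commute) (simp add: form measurable_noise_form[OF N])

text \<open>The deterministic shift \<open>x\<close> only changes the phase of the cosine, so equal
  variances of all linear forms give equal laws.\<close>

lemma distr_eq_if_noise_form_variance_eq:
  fixes f g :: "'a \<Rightarrow> 'e::euclidean_space"
  assumes "prob_space M" and D: "query_assms D" and N: "noise_assms M D N"
    and f: "\<And>\<tau> w. \<tau> \<bullet> f w = noise_form D (B \<tau>) (N w)" and g: "\<And>\<tau> w. \<tau> \<bullet> g w = noise_form D (C \<tau>) (N w)"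
    and eq: "\<And>\<tau>. noise_form_variance D (B \<tau>) = noise_form_variance D (C \<tau>)"
  shows "distr M borel (\<lambda>w. f w + x) = distr M borel (\<lambda>w. g w + x)"
proof -
  interpret prob_space M by fact
  have [measurable]: "f \<in> borel_measurable M" "g \<in> borel_measurable M"
    using measurable_if_noise_form[OF N f] measurable_if_noise_form[OF N g] by simp_all
  show ?thesis
  proof (rule measure_eq_if_cos_integrals_eq)
    fix s :: 'e and c
    have "(\<integral>w. cos (s \<bullet> (f w + x) + c) \<partial>M) = (\<integral>w. cos (s \<bullet> (g w + x) + c) \<partial>M)"
      using integral_cos_noise_form[OF \<open>prob_space M\<close> D N, of _ "s \<bullet> x + c"]
      by (simp add: inner_add_right f g eq add.assoc)
    then show "(\<integral>y. cos (s \<bullet> y + c) \<partial>distr M borel (\<lambda>w. f w + x)) = (\<integral>y. cos (s \<bullet> y + c) \<partial>distr M borel (\<lambda>w. g w + x))"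
      by (simp add: integral_distr)
  qed (auto intro!: prob_space_distr)
qed

theorem theorem1:
  fixes M :: "'a measure"
    and D :: "('n::finite, 'm::finite, 'l::{finite,linorder}, 'j::finite, 'z::finite, 'y::finite) query_data"
    and N :: "'a \<Rightarrow> ('n, 'm, 'l, 'j, 'z) noise"
    and \<sigma> z :: real
  assumes "prob_space M"
    and "query_assms D"
    and "noise_assms M D N"
    and "\<sigma> > 0"
  shows
    "(\<forall>w\<in>space M. \<exists>!\<xi>. psi D \<sigma> z (N w) \<xi> + rho0 D \<xi> = 0) \<and>
     (\<forall>w\<in>space M. \<exists>!\<xi>. phi' D \<sigma> z (N w) \<xi> + rho0 D \<xi> = 0) \<and>
     (\<lambda>w. xi_psi D \<sigma> z (N w)) \<in> borel_measurable M \<and>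
     (\<lambda>w. xi_phi' D \<sigma> z (N w)) \<in> borel_measurable M \<and>
     distr M borel (\<lambda>w. xi_psi D \<sigma> z (N w)) = distr M borel (\<lambda>w. xi_phi' D \<sigma> z (N w)) \<and>
     (\<forall>h :: ('n, 'm, 'l, 'j) state \<Rightarrow> real. h \<in> borel_measurable borel \<longrightarrow>
        (integrable M (\<lambda>w. h (xi_psi D \<sigma> z (N w))) \<longleftrightarrow>
         integrable M (\<lambda>w. h (xi_phi' D \<sigma> z (N w)))) \<and>
        (\<integral>w. h (xi_psi D \<sigma> z (N w)) \<partial>M) = (\<integral>w. h (xi_phi' D \<sigma> z (N w)) \<partial>M))"
proof -
  note D = assms(2) and N = assms(3) and \<sigma> = assms(4)
  interpret staged_space "agree_before :: nat \<Rightarrow> ('n, 'm, 'l, 'j) state \<Rightarrow> _" "2 * CARD('l) + 1"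
    by (rule staged_space_state)
  define K where "K = 2 * CARD('l) + 1"
  \<comment> \<open>Adding \<xi> to both sides turns the equation into a fixed-point equation with
    causal right-hand side.\<close>
  define g where "g w \<xi> = psi D \<sigma> z (N w) \<xi> + (rho0 D \<xi> + \<xi>)" for w \<xi>
  define h where "h w \<xi> = phi' D \<sigma> z (N w) \<xi> + (rho0 D \<xi> + \<xi>)" for w \<xi>
  have g_parts: "fst (g w \<xi>) = fst (psi D \<sigma> z (N w) \<xi>) + fst (rho0 D \<xi> + \<xi>)"
    "snd (g w \<xi>) = snd (psi D \<sigma> z (N w) \<xi>) + snd (rho0 D \<xi> + \<xi>)" for w \<xi>
    by (simp_all add: g_def)
  have causal_g: "causal agree_before (g w)" for w
    by (rule causal_agree_beforeI; unfold g_parts; rule same_cols_le_add;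
      rule psi_causal_fst[OF D \<sigma>] psi_causal_snd[OF D \<sigma>] rho0_causal[OF D \<sigma>]; assumption)
  have h_parts: "fst (h w \<xi>) = fst (phi' D \<sigma> z (N w) \<xi>) + fst (rho0 D \<xi> + \<xi>)"
    "snd (h w \<xi>) = snd (phi' D \<sigma> z (N w) \<xi>) + snd (rho0 D \<xi> + \<xi>)" for w \<xi>
    by (simp_all add: h_def)
  have causal_h: "causal agree_before (h w)" for w
    by (rule causal_agree_beforeI; unfold h_parts; rule same_cols_le_add;
      rule phi'_causal_fst[OF D \<sigma>] phi'_causal_snd[OF D \<sigma>] rho0_causal[OF D \<sigma>]; assumption)
  have cont: "continuous_on UNIV (g w)" "continuous_on UNIV (h w)" for w
    unfolding g_def[abs_def] h_def[abs_def]
    by (intro continuous_intros continuous_psi[OF D \<sigma>] continuous_phi'[OF D \<sigma>] continuous_rho0[OF D \<sigma>])+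
  have psi_meas: "(\<lambda>w. psi D \<sigma> z (N w) \<xi>) \<in> borel_measurable M" for \<xi>
    using measurable_if_noise_form[OF N inner_psi[OF D]] .
  have phi'_meas: "(\<lambda>w. phi' D \<sigma> z (N w) \<xi>) \<in> borel_measurable M" for \<xi>
    using measurable_if_noise_form[OF N inner_phi'[OF D]] .
  have meas: "(\<lambda>w. g w \<xi>) \<in> borel_measurable M" "(\<lambda>w. h w \<xi>) \<in> borel_measurable M" for \<xi>
    unfolding g_def h_def using psi_meas phi'_meas by simp_all
  have distr: "distr M borel (\<lambda>w. g w \<xi>) = distr M borel (\<lambda>w. h w \<xi>)" for \<xi>
    unfolding g_def h_def
    by (rule distr_eq_if_noise_form_variance_eq[OF assms(1-3) inner_psi[OF D] inner_phi'[OF D]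
        noise_form_variance_eq_psi_phi'[OF D \<sigma>]])
  have psi_iff: "psi D \<sigma> z (N w) \<xi> + rho0 D \<xi> = 0 \<longleftrightarrow> \<xi> = (g w ^^ K) 0" for w \<xi>
    using causal_fixpoint_iff[OF causal_g, of w \<xi>] by (simp add: g_def K_def flip: add.assoc)
  have phi'_iff: "phi' D \<sigma> z (N w) \<xi> + rho0 D \<xi> = 0 \<longleftrightarrow> \<xi> = (h w ^^ K) 0" for w \<xi>
    using causal_fixpoint_iff[OF causal_h, of w \<xi>] by (simp add: h_def K_def flip: add.assoc)
  have xi: "xi_psi D \<sigma> z (N w) = (g w ^^ K) 0" "xi_phi' D \<sigma> z (N w) = (h w ^^ K) 0" for w
    by (simp_all add: xi_psi_def xi_phi'_def psi_iff phi'_iff)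
  have xi_meas: "(\<lambda>w. xi_psi D \<sigma> z (N w)) \<in> borel_measurable M" "(\<lambda>w. xi_phi' D \<sigma> z (N w)) \<in> borel_measurable M"
    unfolding xi by (intro measurable_causal_funpow cont meas)+
  have xi_distr: "distr M borel (\<lambda>w. xi_psi D \<sigma> z (N w)) = distr M borel (\<lambda>w. xi_phi' D \<sigma> z (N w))"
    unfolding xi K_def by (rule distr_causal_fixpoint_eq[OF assms(1) causal_g causal_h cont meas distr])
  \<comment> \<open>Here \<open>h\<close> is the test function and shadows the map \<open>h\<close>.
    The change of variables needs no integrability, as the integral of a non-integrable function is
    0.\<close>
  have "(integrable M (\<lambda>w. h (xi_psi D \<sigma> z (N w))) \<longleftrightarrow> integrable M (\<lambda>w. h (xi_phi' D \<sigma> z (N w)))) \<and>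
      (\<integral>w. h (xi_psi D \<sigma> z (N w)) \<partial>M) = (\<integral>w. h (xi_phi' D \<sigma> z (N w)) \<partial>M)"
    if "h \<in> borel_measurable borel" for h :: "('n, 'm, 'l, 'j) state \<Rightarrow> real"
    using integrable_distr_eq[OF xi_meas(1) that] integrable_distr_eq[OF xi_meas(2) that]
      integral_distr[OF xi_meas(1) that] integral_distr[OF xi_meas(2) that]
    by (simp add: xi_distr)
  then show ?thesis
    using xi_meas xi_distr by (simp add: psi_iff phi'_iff)
qed

end
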